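(* Consider the standard stochastic blockmodel on $n$ nodes: the nodes are partitioned into $r$ clusters each of size exactly $K$ (no outliers), and edges between distinct pairs are drawn independently with probability exactly $p$ within clusters and exactly $q$ across clusters, $p>q$. Let $A$ be the adjacency matrix (with $a_{ii}=1$). Run the following procedure: (1) compute the eigenvalues of $A$ sorted as $\hat\lambda_1>\hat\lambda_2>\dots>\hat\lambda_n$; (2) set $\hat r=\arg\max_{i=2,\dots,n-1}(\hat\lambda_i-\hat\lambda_{i+1})$ and $\hat K=n/\hat r$; (3) set $$\hat p=\frac{\hat K\hat\lambda_1+(n-\hat K)\hat\lambda_2-n}{n(\hat K-1)},\qquad \hat q=\frac{\hat\lambda_1-\hat\lambda_2}{n};$$ (4) set $t=(\hat p+\hat q)/2$. Suppose $$\frac{p-q}{\sqrt{p(1-q)}}\ \ge\ c_1\max\left\{\frac{\sqrt{n}}{K},\ \frac{\log^2 n}{\sqrt{K}}\right\}$$ where $c_1$ is an absolute constant. Then with high probability, for an absolute constant $c_4>0$, $$\hat K=K,\qquad \max\{|\hat p-p|,|\hat q-q|\}\le c_4\frac{\sqrt{p(1-q)n}}{K},\qquad \tfrac14 p+\tfrac34 q\le t\le \tfrac34 p+\tfrac14 q.$$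
   Context: "With high probability" means with probability at least $1-c_0n^{-8}$ for a universal constant $c_0$. $c_1$ is the (suitably large) absolute constant appearing in the paper's main recovery condition.
   Formalization: The number of clusters is assumed to be at least 2: with r = 1 the procedure only considers values of r-hat from 2 to n−1, so K-hat can never equal K = n and the claim fails. *)

theory Defs
  imports "Jordan_Normal_Form.Char_Poly" "HOL-Probability.Product_PMF"
begin

definition node_pairs :: "nat \<Rightarrow> (nat \<times> nat) set" where
  "node_pairs n = {(i,j). i < j \<and> j < n}"

definition balanced_clusters :: "nat \<Rightarrow> nat \<Rightarrow> nat \<Rightarrow> (nat \<Rightarrow> nat) \<Rightarrow> bool" where
  "balanced_clusters n r K cl \<longleftrightarrow>
     (\<forall>i<n. cl i < r) \<and> (\<forall>k<r. card {i. i < n \<and> cl i = k} = K)"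

definition sbm :: "nat \<Rightarrow> (nat \<Rightarrow> nat) \<Rightarrow> real \<Rightarrow> real \<Rightarrow> (nat \<times> nat \<Rightarrow> bool) pmf" where
  "sbm n cl p q = Pi_pmf (node_pairs n) False
      (\<lambda>(i,j). bernoulli_pmf (if cl i = cl j then p else q))"

definition adj_matrix :: "nat \<Rightarrow> (nat \<times> nat \<Rightarrow> bool) \<Rightarrow> real mat" where
  "adj_matrix n E = Matrix.mat n n (\<lambda>(i,j). if i = j then 1
                         else if E (min i j, max i j) then 1 else 0)"

text \<open>Eigenvalues (with multiplicity) sorted non-increasingly; lam i = \<lambda>_i for i = 1..n.\<close>
definition sorted_eigs :: "real mat \<Rightarrow> real list" where
  "sorted_eigs A = rev (sorted_list_of_multiset (proots (char_poly A)))"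

definition lam :: "real mat \<Rightarrow> nat \<Rightarrow> real" where
  "lam A i = sorted_eigs A ! (i - 1)"

definition gap_argmax :: "nat \<Rightarrow> real mat \<Rightarrow> nat set" where
  "gap_argmax n A = {i. 2 \<le> i \<and> i \<le> n - 1 \<and>
      (\<forall>j. 2 \<le> j \<and> j \<le> n - 1 \<longrightarrow> lam A j - lam A (j+1) \<le> lam A i - lam A (i+1))}"

definition p_hat :: "nat \<Rightarrow> real \<Rightarrow> real mat \<Rightarrow> real" where
  "p_hat n Kh A = (Kh * lam A 1 + (real n - Kh) * lam A 2 - real n) / (real n * (Kh - 1))"

definition q_hat :: "nat \<Rightarrow> real mat \<Rightarrow> real" where
  "q_hat n A = (lam A 1 - lam A 2) / real n"

definition good_event :: "nat \<Rightarrow> nat \<Rightarrow> real \<Rightarrow> real \<Rightarrow> real \<Rightarrow> (nat \<times> nat \<Rightarrow> bool) \<Rightarrow> bool" where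
  "good_event n K p q c4 E \<longleftrightarrow>
     (let A = adj_matrix n E in
      \<forall>rh \<in> gap_argmax n A.
        let Kh = real n / real rh; ph = p_hat n Kh A; qh = q_hat n A; t = (ph + qh) / 2 in
        Kh = real K \<and>
        max \<bar>ph - p\<bar> \<bar>qh - q\<bar> \<le> c4 * sqrt (p * (1 - q) * real n) / real K \<and>
        p/4 + 3*q/4 \<le> t \<and> t \<le> 3*p/4 + q/4)"

end

theory Submission
  imports Defs
begin

text \<open>
  Write the adjacency matrix as its mean plus a noise matrix M and put s = sqrt (n p (1 - q)).
  The mean is (1 - p) I + (p - q) (cluster blocks) + q J, whose spectrum is 1 - p + (p - q) K + q n
  (once), 1 - p + (p - q) K (r - 1 times) and 1 - p (n - r times). If M has norm at most 12 s, the
  min-max principle moves each eigenvalue by at most 12 s, while the hypothesis makes the gap (p - q) K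
  at least 300 s; so the largest gap is at position r and the two estimators are off by at most 24 s / K.

  The norm of M is controlled by the trace method: the expected trace of the m-th power, m of order
  log n, is a sum over closed walks in which only walks using no edge exactly once contribute.
  Rather than encoding walks, one bounds the total weight of all continuations of a walk prefix by
  induction on the number of remaining steps. A step along an edge used once so far is forced unless
  the current vertex has several such edges, and a potential shows that these ambiguous steps are paid
  for by the steps back to vertices already visited. The step counts balance exactly when
  s is at least the square of the number of visited vertices, that is s^2 is of order log^4 n.
\<close>

section \<open>Eigenvalues of symmetric matrices\<close>

text \<open>The hypothesis makes the gap only a constant multiple of s, so a norm bound that loses a
  power of log n would be useless. The trace of the m-th power loses just the factor n, whose m-th
  root is bounded once m is of order log n. With a norm threshold of three times the growth rate 4 s
  and m \<ge> 9 ln n, Markov's inequality leaves n / 3^m \<le> n^-8.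

  The rate is s for the following reason. An edge to a new vertex has at most n choices and, once
  repeated, contributes a moment of at most v = p (1 - q). The product n v = s^2 is shared by the
  first and the second traversal, one s each. Edges still waiting for their second traversal are a
  debt, recorded by the division by a power of s in \<open>walk_bound\<close>.

  The requirement that s dominate the squared walk length is where the log^2 n term of the
  hypothesis enters: since p - q \<le> 2 v and K \<le> n, it yields c1 (ln n)^2 \<le> 2 s.\<close>

definition dotp :: "nat \<Rightarrow> (nat \<Rightarrow> real) \<Rightarrow> (nat \<Rightarrow> real) \<Rightarrow> real" where
  "dotp n x y = (\<Sum>i<n. x i * y i)"

text \<open>Vectors and matrices are plain functions of which only the values at indices below
  \<open>n\<close> count. This avoids carrier conditions; eigenvector equations are stated pointwise
  below \<open>n\<close>.\<close>

definition mvec :: "nat \<Rightarrow> (nat \<Rightarrow> nat \<Rightarrow> real) \<Rightarrow> (nat \<Rightarrow> real) \<Rightarrow> nat \<Rightarrow> real" where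
  "mvec n a x = (\<lambda>i. \<Sum>j<n. a i j * x j)"

lemma dotp_commute: "dotp n x y = dotp n y x"
  by (simp add: dotp_def mult.commute)

lemma dotp_add_right: "dotp n x (\<lambda>i. y i + z i) = dotp n x y + dotp n x z"
  by (simp add: dotp_def distrib_left sum.distrib)

lemma dotp_diff_right: "dotp n x (\<lambda>i. y i - z i) = dotp n x y - dotp n x z"
  by (simp add: dotp_def right_diff_distrib sum_subtractf)

lemma dotp_scale_right: "dotp n x (\<lambda>i. c * y i) = c * dotp n x y"
  by (simp add: dotp_def sum_distrib_left mult.left_commute)

lemma dotp_sum_right: "dotp n x (\<lambda>i. \<Sum>k\<in>S. c k * y k i) = (\<Sum>k\<in>S. c k * dotp n x (y k))"
  unfolding dotp_def sum_distrib_left by (subst sum.swap) (simp add: mult.left_commute)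

lemma dotp_add_left: "dotp n (\<lambda>i. y i + z i) x = dotp n y x + dotp n z x"
  using dotp_add_right dotp_commute by metis

lemma dotp_scale_left: "dotp n (\<lambda>i. c * y i) x = c * dotp n y x"
  using dotp_scale_right dotp_commute by metis

lemma dotp_sum_left: "dotp n (\<lambda>i. \<Sum>k\<in>S. c k * y k i) x = (\<Sum>k\<in>S. c k * dotp n (y k) x)"
  using dotp_sum_right[of n x c y S] by (simp add: dotp_commute)

lemma dotp_cong: "(\<And>i. i < n \<Longrightarrow> x i = x' i) \<Longrightarrow> (\<And>i. i < n \<Longrightarrow> y i = y' i) \<Longrightarrow> dotp n x y = dotp n x' y'"
  by (simp add: dotp_def)

lemma dotp_self_nonneg: "0 \<le> dotp n x x"
  by (simp add: dotp_def sum_nonneg)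

lemma dotp_self_eq_0: "dotp n x x = 0 \<longleftrightarrow> (\<forall>i<n. x i = 0)"
  unfolding dotp_def by (subst sum_nonneg_eq_0_iff) auto

lemma dotp_Cauchy_Schwarz: "(dotp n x y)\<^sup>2 \<le> dotp n x x * dotp n y y"
  using Cauchy_Schwarz_ineq_sum[of x y "{..<n}"] by (simp add: dotp_def power2_eq_square)

lemma mvec_add: "mvec n a (\<lambda>i. x i + y i) = (\<lambda>i. mvec n a x i + mvec n a y i)"
  by (simp add: mvec_def distrib_left sum.distrib)

lemma mvec_scale: "mvec n a (\<lambda>i. c * x i) = (\<lambda>i. c * mvec n a x i)"
  by (simp add: mvec_def sum_distrib_left mult.left_commute)

lemma mvec_sum: "mvec n a (\<lambda>i. \<Sum>k\<in>S. c k * y k i) = (\<lambda>i. \<Sum>k\<in>S. c k * mvec n a (y k) i)"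
  unfolding mvec_def sum_distrib_left by (subst sum.swap) (simp add: mult.left_commute)

lemma mvec_cong: "(\<And>i. i < n \<Longrightarrow> x i = y i) \<Longrightarrow> mvec n a x = mvec n a y"
  by (simp add: mvec_def)

lemma mvec_matrix_add: "mvec n (\<lambda>i j. a i j + b i j) x = (\<lambda>i. mvec n a x i + mvec n b x i)"
  by (simp add: mvec_def distrib_right sum.distrib)

definition symm :: "nat \<Rightarrow> (nat \<Rightarrow> nat \<Rightarrow> real) \<Rightarrow> bool" where
  "symm n a \<longleftrightarrow> (\<forall>i<n. \<forall>j<n. a i j = a j i)"

lemma dotp_mvec_symm:
  assumes "symm n a"
  shows "dotp n x (mvec n a y) = dotp n (mvec n a x) y"
proof -
  have "dotp n x (mvec n a y) = (\<Sum>i<n. \<Sum>j<n. x i * a i j * y j)"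
    by (simp add: dotp_def mvec_def sum_distrib_left mult.assoc)
  also have "\<dots> = (\<Sum>j<n. \<Sum>i<n. x i * a i j * y j)" by (rule sum.swap)
  also have "\<dots> = dotp n (mvec n a x) y"
    unfolding dotp_def mvec_def sum_distrib_right
    by (intro sum.cong refl) (use assms in \<open>auto simp: symm_def\<close>)
  finally show ?thesis .
qed

section \<open>Existence of an ordered orthonormal eigenbasis\<close>

text \<open>Padding the system with zero rows to a square matrix makes the determinant vanish, and a
  kernel vector is a solution. This is the dimension count behind the min-max bounds.\<close>

lemma homogeneous_solution:
  fixes g :: "nat \<Rightarrow> nat \<Rightarrow> real"
  assumes "k < n"
  shows "\<exists>c. (\<exists>i<n. c i \<noteq> 0) \<and> (\<forall>j<k. dotp n (g j) c = 0)"
proof -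
  define r where "r = (\<lambda>i. Matrix.vec n (\<lambda>j. if i < k then g i j else 0))"
  define A where "A = mat\<^sub>r n n (\<lambda>i. if i = k then 0\<^sub>v n else r i)"
  have A: "A \<in> carrier_mat n n" by (simp add: A_def)
  have "Determinant.det A = 0" unfolding A_def
    by (rule Determinant.det_row_0[OF assms]) (auto simp: r_def)
  then obtain v where v: "v \<in> carrier_vec n" "v \<noteq> 0\<^sub>v n" "A *\<^sub>v v = 0\<^sub>v n"
    using det_0_iff_vec_prod_zero_field[OF A] by blast
  have "\<exists>i<n. vec_index v i \<noteq> 0"
  proof (rule ccontr)
    assume "\<not> ?thesis"
    hence "v = 0\<^sub>v n" using v(1) by (intro eq_vecI) auto
    with v(2) show False by simp
  qed
  moreover have "dotp n (g j) (\<lambda>i. vec_index v i) = 0" if "j < k" for j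
  proof -
    have "0 = vec_index (A *\<^sub>v v) j" using v(3) that assms by simp
    also have "\<dots> = dotp n (g j) (\<lambda>i. vec_index v i)"
      using that assms v(1) A
      by (auto simp: A_def r_def scalar_prod_def dotp_def atLeast0LessThan intro!: sum.cong)
    finally show ?thesis by simp
  qed
  ultimately show ?thesis by (intro exI[of _ "\<lambda>i. vec_index v i"]) auto
qed

text \<open>Bolzano-Weierstrass for vectors encoded as functions: each further coordinate is made
  convergent by passing to a monotone subsequence.\<close>

lemma bounded_coordinates_convergent_subseq:
  fixes f :: "nat \<Rightarrow> nat \<Rightarrow> real"
  assumes "\<And>m i. i < n \<Longrightarrow> \<bar>f m i\<bar> \<le> B"
  shows "\<exists>r l. strict_mono r \<and> (\<forall>i<n. (\<lambda>m. f (r m) i) \<longlonglongrightarrow> l i)"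
  using assms
proof (induction n)
  case 0
  show ?case by (intro exI[of _ id]) (auto simp: strict_mono_def)
next
  case (Suc n)
  then obtain r l where r: "strict_mono r" "\<forall>i<n. (\<lambda>m. f (r m) i) \<longlonglongrightarrow> l i"
    by fastforce
  obtain t where t: "strict_mono t" "monoseq (\<lambda>m. f (r (t m)) n)"
    using seq_monosub[of "\<lambda>m. f (r m) n"] by blast
  have "Bseq (\<lambda>m. f (r (t m)) n)"
    using Suc.prems by (intro BseqI'[of _ B]) auto
  hence "convergent (\<lambda>m. f (r (t m)) n)" using t(2) by (rule Bseq_monoseq_convergent)
  then obtain y where y: "(\<lambda>m. f (r (t m)) n) \<longlonglongrightarrow> y" by (auto simp: convergent_def)
  have "(\<lambda>m. f ((r \<circ> t) m) i) \<longlonglongrightarrow> (l(n := y)) i" if "i < Suc n" for i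
  proof (cases "i = n")
    case False
    hence "(\<lambda>m. f (r m) i) \<longlonglongrightarrow> l i" using r(2) that by auto
    from LIMSEQ_subseq_LIMSEQ[OF this t(1)] show ?thesis using False by (simp add: o_def)
  qed (use y in simp)
  moreover have "strict_mono (r \<circ> t)" using r(1) t(1) by (rule strict_mono_o)
  ultimately show ?case by blast
qed

lemma dotp_self_pos_iff: "0 < dotp n x x \<longleftrightarrow> (\<exists>i<n. x i \<noteq> 0)"
  using dotp_self_nonneg[of n x] dotp_self_eq_0[of n x] by (auto simp: less_le)

lemma quadratic_form_scale:
  "dotp n (\<lambda>i. c * x i) (mvec n a (\<lambda>i. c * x i)) = c\<^sup>2 * dotp n x (mvec n a x)"
  by (simp add: mvec_scale dotp_scale_left dotp_scale_right power2_eq_square)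

text \<open>Compactness of the unit sphere in the orthogonal complement of the \<open>u i\<close>,
  which is nonempty because \<open>k < n\<close>. The inequality is in homogeneous form so that
  later uses need no normalisation.\<close>

lemma Rayleigh_quotient_attains_max:
  fixes u :: "nat \<Rightarrow> nat \<Rightarrow> real"
  assumes "k < n"
  shows "\<exists>v. dotp n v v = 1 \<and> (\<forall>i<k. dotp n (u i) v = 0) \<and>
    (\<forall>x. (\<forall>i<k. dotp n (u i) x = 0) \<longrightarrow>
      dotp n x (mvec n a x) \<le> dotp n v (mvec n a v) * dotp n x x)"
proof -
  define Q where "Q = (\<lambda>x. dotp n x (mvec n a x))"
  define S where "S = {x. dotp n x x = 1 \<and> (\<forall>i<k. dotp n (u i) x = 0)}"
  have normalise: "(\<lambda>i. x i / sqrt (dotp n x x)) \<in> S"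
    "Q x = Q (\<lambda>i. x i / sqrt (dotp n x x)) * dotp n x x"
    if "0 < dotp n x x" "\<forall>i<k. dotp n (u i) x = 0" for x
  proof -
    let ?c = "inverse (sqrt (dotp n x x))"
    have c2: "?c\<^sup>2 * dotp n x x = 1" using that(1) by (simp add: power_inverse)
    have eq: "(\<lambda>i. x i / sqrt (dotp n x x)) = (\<lambda>i. ?c * x i)" by (simp add: divide_inverse mult.commute)
    show "(\<lambda>i. x i / sqrt (dotp n x x)) \<in> S"
      unfolding eq S_def using that c2
      by (simp add: dotp_scale_left dotp_scale_right power2_eq_square mult.assoc)
    show "Q x = Q (\<lambda>i. x i / sqrt (dotp n x x)) * dotp n x x"
      unfolding eq Q_def quadratic_form_scale using c2 by (simp add: algebra_simps)
  qed
  have le1: "\<bar>x i\<bar> \<le> 1" if "x \<in> S" "i < n" for x i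
  proof -
    have "x i * x i \<le> (\<Sum>i<n. x i * x i)" using that by (intro member_le_sum) auto
    hence "(x i)\<^sup>2 \<le> 1" using that by (simp add: S_def dotp_def power2_eq_square)
    thus ?thesis by (simp add: abs_square_le_1)
  qed
  have Qbd: "Q x \<le> (\<Sum>i<n. \<Sum>j<n. \<bar>a i j\<bar>)" if "x \<in> S" for x
  proof -
    have "Q x = (\<Sum>i<n. \<Sum>j<n. x i * (a i j * x j))"
      by (simp add: Q_def dotp_def mvec_def sum_distrib_left)
    also have "\<dots> \<le> (\<Sum>i<n. \<Sum>j<n. \<bar>a i j\<bar>)"
    proof (intro sum_mono)
      fix i j assume "i \<in> {..<n}" "j \<in> {..<n}"
      hence "\<bar>x i\<bar> \<le> 1" "\<bar>x j\<bar> \<le> 1" using le1 that by auto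
      hence "\<bar>x i\<bar> * \<bar>x j\<bar> * \<bar>a i j\<bar> \<le> 1 * 1 * \<bar>a i j\<bar>" by (intro mult_mono) auto
      moreover have "x i * (a i j * x j) \<le> \<bar>x i * (a i j * x j)\<bar>" by simp
      ultimately show "x i * (a i j * x j) \<le> \<bar>a i j\<bar>" by (simp add: abs_mult mult_ac)
    qed
    finally show ?thesis .
  qed
  obtain c where c: "\<exists>i<n. c i \<noteq> 0" "\<forall>j<k. dotp n (u j) c = 0"
    using homogeneous_solution[OF assms] by blast
  have ne: "S \<noteq> {}" using normalise(1)[of c] c dotp_self_pos_iff by blast
  define M where "M = Sup (Q ` S)"
  have bdd: "bdd_above (Q ` S)" using Qbd by (auto intro!: bdd_aboveI2)
  have "\<exists>x\<in>S. M - 1 / real (Suc m) < Q x" for m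
    using less_cSup_iff[of "Q ` S" "M - 1 / real (Suc m)"] ne bdd by (auto simp: M_def)
  then obtain f where f: "\<And>m. f m \<in> S" "\<And>m. M - 1 / real (Suc m) < Q (f m)" by metis
  obtain r l where r: "strict_mono r" and lim: "\<forall>i<n. (\<lambda>m. f (r m) i) \<longlonglongrightarrow> l i"
    using bounded_coordinates_convergent_subseq[of n f 1] le1 f(1) by blast
  have limdot: "(\<lambda>m. dotp n w (f (r m))) \<longlonglongrightarrow> dotp n w l" for w
    unfolding dotp_def using lim by (intro tendsto_intros) auto
  have "(\<lambda>m. dotp n (f (r m)) (f (r m))) \<longlonglongrightarrow> dotp n l l"
    unfolding dotp_def using lim by (intro tendsto_intros) auto
  moreover have "(\<lambda>m. dotp n (f (r m)) (f (r m))) = (\<lambda>_. 1)" using f(1) by (simp add: S_def)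
  ultimately have l1: "dotp n l l = 1" by (metis LIMSEQ_unique tendsto_const)
  have l2: "dotp n (u i) l = 0" if "i < k" for i
  proof -
    have "(\<lambda>m. dotp n (u i) (f (r m))) = (\<lambda>_. 0)" using f(1) that by (simp add: S_def)
    thus ?thesis using limdot[of "u i"] by (metis LIMSEQ_unique tendsto_const)
  qed
  have "(\<lambda>m. Q (f (r m))) \<longlonglongrightarrow> Q l"
    unfolding Q_def dotp_def mvec_def using lim by (intro tendsto_intros) auto
  moreover have "(\<lambda>m. M - 1 / real (Suc (r m))) \<longlonglongrightarrow> M"
  proof -
    have "(\<lambda>m. M - 1 / real (Suc m)) \<longlonglongrightarrow> M - 0"
      by (intro tendsto_diff tendsto_const) (rule LIMSEQ_inverse_real_of_nat[unfolded inverse_eq_divide])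
    from LIMSEQ_subseq_LIMSEQ[OF this r] show ?thesis by (simp add: o_def)
  qed
  ultimately have "M \<le> Q l" using f(2) by (intro LIMSEQ_le[of _ M _ "Q l"]) (auto intro: less_imp_le)
  moreover have "Q x \<le> M" if "x \<in> S" for x unfolding M_def using bdd that by (auto intro: cSup_upper)
  ultimately have max: "Q x \<le> Q l" if "x \<in> S" for x using that by fastforce
  have "Q x \<le> Q l * dotp n x x" if "\<forall>i<k. dotp n (u i) x = 0" for x
  proof (cases "0 < dotp n x x")
    case True
    show ?thesis using normalise[OF True that] max by (metis True mult_right_mono less_imp_le)
  next
    case False
    hence "\<forall>i<n. x i = 0" using dotp_self_pos_iff by blast
    hence "Q x = 0" "dotp n x x = 0" by (auto simp: Q_def dotp_def)
    thus ?thesis by simp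
  qed
  thus ?thesis using l1 l2 by (intro exI[of _ l]) (auto simp: Q_def)
qed

text \<open>The residual \<open>y\<close> of the eigenvalue equation is orthogonal to
  \<open>v\<close> and to all \<open>u i\<close>, so \<open>v + t y\<close> is again admissible.
  Along this line the form grows by 2 t |y|^2 to first order, while maximality allows only
  second-order growth; hence \<open>y\<close> vanishes.\<close>

lemma constrained_maximiser_is_eigenvector:
  assumes sym: "symm n a"
    and eig: "\<And>i. i < k \<Longrightarrow> \<forall>x<n. mvec n a (u i) x = e i * u i x"
    and v1: "dotp n v v = 1" and vorth: "\<And>i. i < k \<Longrightarrow> dotp n (u i) v = 0"
    and max: "\<And>x. (\<And>i. i < k \<Longrightarrow> dotp n (u i) x = 0) \<Longrightarrow>
      dotp n x (mvec n a x) \<le> dotp n v (mvec n a v) * dotp n x x"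
  shows "\<forall>x<n. mvec n a v x = dotp n v (mvec n a v) * v x"
proof -
  define l where "l = dotp n v (mvec n a v)"
  define y where "y = (\<lambda>i. mvec n a v i - l * v i)"
  have yv: "dotp n v y = 0" by (simp add: y_def dotp_diff_right dotp_scale_right v1 l_def)
  have yu: "dotp n (u i) y = 0" if "i < k" for i
  proof -
    have "dotp n (u i) (mvec n a v) = dotp n (mvec n a (u i)) v" by (rule dotp_mvec_symm[OF sym])
    also have "\<dots> = dotp n (\<lambda>x. e i * u i x) v" using eig[OF that] by (intro dotp_cong) auto
    finally show ?thesis using vorth[OF that]
      by (simp add: y_def dotp_diff_right dotp_scale_right dotp_scale_left)
  qed
  have yAv: "dotp n y (mvec n a v) = dotp n y y"
  proof -
    have "dotp n y y = dotp n y (mvec n a v) - l * dotp n y v"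
      by (subst (2) y_def) (simp add: dotp_diff_right dotp_scale_right)
    thus ?thesis using yv by (simp add: dotp_commute)
  qed
  define b where "b = dotp n y (mvec n a y)"
  define s where "s = dotp n y y"
  have key: "2 * t * s + t\<^sup>2 * b \<le> l * t\<^sup>2 * s" for t
  proof -
    let ?x = "\<lambda>i. v i + t * y i"
    have "dotp n (u i) ?x = 0" if "i < k" for i
      using that vorth yu by (simp add: dotp_add_right dotp_scale_right)
    hence "dotp n ?x (mvec n a ?x) \<le> l * dotp n ?x ?x" using max unfolding l_def by blast
    moreover have "dotp n ?x ?x = 1 + t\<^sup>2 * s"
      using yv by (simp add: dotp_add_right dotp_scale_right dotp_add_left dotp_scale_left v1 s_def
          dotp_commute[of n y v] power2_eq_square)
    moreover have "dotp n v (mvec n a y) = s"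
      using dotp_mvec_symm[OF sym, of v y] yAv by (simp add: s_def dotp_commute)
    hence "dotp n ?x (mvec n a ?x) = l + 2 * t * s + t\<^sup>2 * b"
      using yAv by (simp add: mvec_add mvec_scale dotp_add_right dotp_scale_right dotp_add_left dotp_scale_left
          l_def[symmetric] s_def[symmetric] b_def[symmetric] power2_eq_square algebra_simps)
    ultimately show ?thesis by (simp add: algebra_simps)
  qed
  have "s \<le> 0"
  proof (rule ccontr)
    assume "\<not> s \<le> 0"
    hence s: "s > 0" by simp
    define d where "d = \<bar>l * s - b\<bar> + 1"
    have d: "d > 0" "l * s - b \<le> d" by (auto simp: d_def)
    have "2 * s * t \<le> t\<^sup>2 * d" if "t > 0" for t
    proof -
      have "2 * s * t \<le> t\<^sup>2 * (l * s - b)" using key[of t] by (simp add: algebra_simps)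
      also have "\<dots> \<le> t\<^sup>2 * d" using d by (intro mult_left_mono) auto
      finally show ?thesis .
    qed
    \<comment> \<open>The point s / d minimises t^2 d - 2 s t.\<close>
    from this[of "s / d"] have "2 * s\<^sup>2 / d \<le> s\<^sup>2 / d" using s d(1)
      by (simp add: power2_eq_square divide_simps)
    thus False using s d(1) by (simp add: divide_simps)
  qed
  hence "\<forall>i<n. y i = 0" using dotp_self_nonneg[of n y] dotp_self_eq_0[of n y] by (simp add: s_def)
  thus ?thesis by (simp add: y_def l_def)
qed

text \<open>Greedy construction: each new vector maximises the form on the complement of the earlier
  ones. The extremal property of each \<open>e i\<close> is kept because it yields both the ordering
  and the min-max bounds.\<close>

lemma ordered_eigenbasis_aux:
  assumes sym: "symm n a" and "k \<le> n"
  shows "\<exists>u e. (\<forall>i<k. \<forall>j<k. dotp n (u i) (u j) = of_bool (i = j)) \<and>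
    (\<forall>i<k. \<forall>x<n. mvec n a (u i) x = e i * u i x) \<and>
    (\<forall>i<k. \<forall>x. (\<forall>j<i. dotp n (u j) x = 0) \<longrightarrow> dotp n x (mvec n a x) \<le> e i * dotp n x x)"
  using \<open>k \<le> n\<close>
proof (induction k)
  case (Suc k)
  then obtain u e where u: "\<forall>i<k. \<forall>j<k. dotp n (u i) (u j) = of_bool (i = j)"
    and eig: "\<forall>i<k. \<forall>x<n. mvec n a (u i) x = e i * u i x"
    and mx: "\<forall>i<k. \<forall>x. (\<forall>j<i. dotp n (u j) x = 0) \<longrightarrow> dotp n x (mvec n a x) \<le> e i * dotp n x x"
    by auto
  obtain v where v: "dotp n v v = 1" "\<forall>i<k. dotp n (u i) v = 0"
    "\<forall>x. (\<forall>i<k. dotp n (u i) x = 0) \<longrightarrow> dotp n x (mvec n a x) \<le> dotp n v (mvec n a v) * dotp n x x"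
    using Rayleigh_quotient_attains_max[of k n u a] Suc.prems by auto
  define l where "l = dotp n v (mvec n a v)"
  have ev: "\<forall>x<n. mvec n a v x = l * v x"
    unfolding l_def using eig v by (intro constrained_maximiser_is_eigenvector[OF sym, of k u e]) auto
  have v2: "\<forall>i<k. dotp n v (u i) = 0" using v(2) by (simp add: dotp_commute)
  show ?case
  proof (intro exI[of _ "u(k := v)"] exI[of _ "e(k := l)"] conjI)
    show "\<forall>i<Suc k. \<forall>j<Suc k. dotp n ((u(k := v)) i) ((u(k := v)) j) = of_bool (i = j)"
      using u v(1,2) v2 by (auto simp: less_Suc_eq)
    show "\<forall>i<Suc k. \<forall>x<n. mvec n a ((u(k := v)) i) x = (e(k := l)) i * (u(k := v)) i x"
      using eig ev by (auto simp: less_Suc_eq)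
    show "\<forall>i<Suc k. \<forall>x. (\<forall>j<i. dotp n ((u(k := v)) j) x = 0) \<longrightarrow>
        dotp n x (mvec n a x) \<le> (e(k := l)) i * dotp n x x"
      using mx v(3) unfolding l_def[symmetric] by (auto simp: less_Suc_eq)
  qed
qed auto

lemma ordered_eigenbasis:
  assumes sym: "symm n a"
  obtains u e where "\<And>i j. i < n \<Longrightarrow> j < n \<Longrightarrow> dotp n (u i) (u j) = of_bool (i = j)"
    "\<And>i x. i < n \<Longrightarrow> x < n \<Longrightarrow> mvec n a (u i) x = e i * u i x"
    "\<And>i x. i < n \<Longrightarrow> (\<And>j. j < i \<Longrightarrow> dotp n (u j) x = 0) \<Longrightarrow> dotp n x (mvec n a x) \<le> e i * dotp n x x"
    "\<And>i j. i \<le> j \<Longrightarrow> j < n \<Longrightarrow> e j \<le> e i"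
proof -
  obtain u e where u: "\<forall>i<n. \<forall>j<n. dotp n (u i) (u j) = of_bool (i = j)"
    and eig: "\<forall>i<n. \<forall>x<n. mvec n a (u i) x = e i * u i x"
    and mx: "\<forall>i<n. \<forall>x. (\<forall>j<i. dotp n (u j) x = 0) \<longrightarrow> dotp n x (mvec n a x) \<le> e i * dotp n x x"
    using ordered_eigenbasis_aux[OF sym order_refl] by blast
  have mono: "e j \<le> e i" if "i \<le> j" "j < n" for i j
  proof -
    have "dotp n (u j) (mvec n a (u j)) = dotp n (u j) (\<lambda>x. e j * u j x)"
      using eig that by (intro dotp_cong) auto
    also have "\<dots> = e j" using u that by (simp add: dotp_scale_right)
    finally have "e j = dotp n (u j) (mvec n a (u j))" ..
    \<comment> \<open>\<open>u j\<close> is orthogonal to all vectors before index \<open>i\<close>,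
      so it competes in the maximum that defines \<open>e i\<close>.\<close>
    also have "\<dots> \<le> e i * dotp n (u j) (u j)"
      using u that by (intro mx[rule_format]) auto
    finally show ?thesis using u that by simp
  qed
  show thesis
  proof (rule that[of u e])
    show "dotp n x (mvec n a x) \<le> e i * dotp n x x"
      if "i < n" "\<And>j. j < i \<Longrightarrow> dotp n (u j) x = 0" for i x
      using mx that by blast
  qed (use u eig mono in auto)
qed

section \<open>Roots of the characteristic polynomial\<close>

lemma char_poly_orthonormal_eigenbasis:
  assumes ortho: "\<And>i j. i < n \<Longrightarrow> j < n \<Longrightarrow> dotp n (u i) (u j) = of_bool (i = j)"
    and eig: "\<And>i x. i < n \<Longrightarrow> x < n \<Longrightarrow> mvec n a (u i) x = e i * u i x"
  shows "char_poly (Matrix.mat n n (\<lambda>(i,j). a i j)) = (\<Prod>i\<leftarrow>[0..<n]. [:- e i, 1:])"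
proof -
  define A where "A = Matrix.mat n n (\<lambda>(i,j). a i j)"
  define U where "U = Matrix.mat n n (\<lambda>(x,i). u i x)"
  define D where "D = Matrix.mat n n (\<lambda>(i,j). if i = j then e i else 0)"
  have carr: "A \<in> carrier_mat n n" "U \<in> carrier_mat n n" "D \<in> carrier_mat n n" "transpose_mat U \<in> carrier_mat n n"
    by (auto simp: A_def U_def D_def)
  have UU: "transpose_mat U * U = 1\<^sub>m n"
    using ortho by (intro eq_matI) (auto simp: U_def scalar_prod_def dotp_def atLeast0LessThan)
  hence UU': "U * transpose_mat U = 1\<^sub>m n"
    using mat_mult_left_right_inverse carr by blast
  have "A * U = U * D"
  proof (intro eq_matI)
    fix x i assume "x < dim_row (U * D)" "i < dim_col (U * D)"
    hence xi: "x < n" "i < n" by (auto simp: U_def D_def)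
    have "(A * U) $$ (x, i) = mvec n a (u i) x"
      using xi by (simp add: A_def U_def scalar_prod_def mvec_def atLeast0LessThan)
    also have "\<dots> = u i x * e i" using eig xi by simp
    also have "\<dots> = (\<Sum>j<n. u j x * (if j = i then e j else 0))"
      using xi by (simp add: if_distrib sum.delta cong: if_cong)
    also have "\<dots> = (U * D) $$ (x, i)"
      using xi by (simp add: U_def D_def scalar_prod_def atLeast0LessThan)
    finally show "(A * U) $$ (x, i) = (U * D) $$ (x, i)" .
  qed (auto simp: A_def U_def D_def)
  hence "A = U * D * transpose_mat U"
    using carr UU' by (metis assoc_mult_mat right_mult_one_mat)
  hence "similar_mat A D" using carr UU UU' by (intro similar_matI[of A D U "transpose_mat U" n]) auto
  hence "char_poly A = char_poly D" by (rule char_poly_similar)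
  also have "\<dots> = (\<Prod> x \<leftarrow> diag_mat D. [:- x, 1:])"
    by (rule char_poly_upper_triangular[OF carr(3)]) (auto simp: D_def)
  also have "diag_mat D = map e [0..<n]" by (auto simp: diag_mat_def D_def)
  finally show ?thesis by (simp add: A_def o_def)
qed

text \<open>Links \<open>lam\<close>, defined through the characteristic polynomial, to the
  eigenbasis. \<open>lam\<close> counts from 1 and the basis from 0, hence
  \<open>Suc i\<close>.\<close>

lemma lam_orthonormal_eigenbasis:
  assumes ortho: "\<And>i j. i < n \<Longrightarrow> j < n \<Longrightarrow> dotp n (u i) (u j) = of_bool (i = j)"
    and eig: "\<And>i x. i < n \<Longrightarrow> x < n \<Longrightarrow> mvec n a (u i) x = e i * u i x"
    and mono: "\<And>i j. i \<le> j \<Longrightarrow> j < n \<Longrightarrow> e j \<le> e i"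
    and "i < n"
  shows "lam (Matrix.mat n n (\<lambda>(i,j). a i j)) (Suc i) = e i"
proof -
  have "proots (\<Prod>i\<leftarrow>xs. [:- e i, 1:]) = mset (map e xs)" for xs :: "nat list"
  proof (induction xs)
    case (Cons x xs)
    have "(\<Prod>i\<leftarrow>xs. [:- e i, 1:]) \<noteq> 0" by (auto simp: prod_list_zero_iff)
    hence "proots ([:- e x, 1:] * (\<Prod>i\<leftarrow>xs. [:- e i, 1:])) =
        proots [:- e x, 1:] + proots (\<Prod>i\<leftarrow>xs. [:- e i, 1:])"
      by (intro proots_mult) auto
    thus ?case using Cons.IH by (simp only: list.map prod_list.Cons proots_linear_factor) simp
  qed simp
  hence pr: "proots (char_poly (Matrix.mat n n (\<lambda>(i,j). a i j))) = mset (map e [0..<n])"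
    using char_poly_orthonormal_eigenbasis[OF ortho eig] by simp
  have "sorted (rev (map e [0..<n]))"
    unfolding sorted_rev_iff_nth_mono using mono by auto
  hence "sort (map e [0..<n]) = rev (map e [0..<n])"
    by (intro properties_for_sort) auto
  hence "sorted_eigs (Matrix.mat n n (\<lambda>(i,j). a i j)) = map e [0..<n]"
    unfolding sorted_eigs_def pr by (metis rev_rev_ident sorted_list_of_multiset_mset)
  thus ?thesis using \<open>i < n\<close> by (simp add: lam_def)
qed

lemma quadratic_form_eigenvectors:
  fixes c :: "nat \<Rightarrow> real"
  assumes ortho: "\<And>i j. i < n \<Longrightarrow> j < n \<Longrightarrow> dotp n (u i) (u j) = of_bool (i = j)"
    and eig: "\<And>i x. i < n \<Longrightarrow> x < n \<Longrightarrow> mvec n a (u i) x = e i * u i x" and "m \<le> n"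
  defines "x \<equiv> \<lambda>i. \<Sum>k<m. c k * u k i"
  shows "dotp n x x = (\<Sum>k<m. (c k)\<^sup>2)" "dotp n x (mvec n a x) = (\<Sum>k<m. e k * (c k)\<^sup>2)"
proof -
  have ux: "dotp n x (u k) = c k" if "k < m" for k
  proof -
    have "dotp n x (u k) = (\<Sum>j<m. c j * dotp n (u j) (u k))"
      unfolding x_def by (rule dotp_sum_left)
    also have "\<dots> = (\<Sum>j<m. if j = k then c j else 0)"
      using ortho that \<open>m \<le> n\<close> by (intro sum.cong) auto
    finally show ?thesis using that by simp
  qed
  show "dotp n x x = (\<Sum>k<m. (c k)\<^sup>2)"
    by (subst (2) x_def, subst dotp_sum_right) (simp add: ux power2_eq_square)
  have "dotp n x (mvec n a x) = dotp n x (\<lambda>i. \<Sum>k<m. c k * mvec n a (u k) i)"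
    by (subst (2) x_def, subst mvec_sum) (rule refl)
  also have "\<dots> = (\<Sum>k<m. c k * dotp n x (mvec n a (u k)))" by (rule dotp_sum_right)
  also have "\<dots> = (\<Sum>k<m. e k * (c k)\<^sup>2)"
  proof (intro sum.cong refl)
    fix k assume k: "k \<in> {..<m}"
    have "dotp n x (mvec n a (u k)) = dotp n x (\<lambda>i. e k * u k i)"
      using eig k \<open>m \<le> n\<close> by (intro dotp_cong) auto
    thus "c k * dotp n x (mvec n a (u k)) = e k * (c k)\<^sup>2"
      using ux k by (simp add: dotp_scale_right power2_eq_square)
  qed
  finally show "dotp n x (mvec n a x) = (\<Sum>k<m. e k * (c k)\<^sup>2)" .
qed

section \<open>Courant-Fischer bounds\<close>

text \<open>Some nontrivial combination of the i + 1 vectors \<open>v k\<close> is orthogonal to the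
  first i eigenvectors, and there the form is at most \<open>e i\<close> times the squared norm.
  Linear independence of the \<open>v k\<close> enters as positivity of
  \<open>dotp n x x\<close>.\<close>

lemma lam_ge_of_subspace:
  assumes sym: "symm n a" and i: "i < n"
    and v: "\<And>c. \<exists>k\<le>i. c k \<noteq> 0 \<Longrightarrow> (let x = (\<lambda>j. \<Sum>k\<le>i. c k * v k j) in
      0 < dotp n x x \<and> \<alpha> * dotp n x x \<le> dotp n x (mvec n a x))"
  shows "\<alpha> \<le> lam (Matrix.mat n n (\<lambda>(i,j). a i j)) (Suc i)"
proof -
  obtain u e where u: "\<And>i j. i < n \<Longrightarrow> j < n \<Longrightarrow> dotp n (u i) (u j) = of_bool (i = j)"
    "\<And>i x. i < n \<Longrightarrow> x < n \<Longrightarrow> mvec n a (u i) x = e i * u i x"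
    "\<And>i x. i < n \<Longrightarrow> (\<And>j. j < i \<Longrightarrow> dotp n (u j) x = 0) \<Longrightarrow> dotp n x (mvec n a x) \<le> e i * dotp n x x"
    "\<And>i j. i \<le> j \<Longrightarrow> j < n \<Longrightarrow> e j \<le> e i"
    using ordered_eigenbasis[OF sym] by blast
  obtain c where c: "\<exists>k<Suc i. c k \<noteq> 0" "\<forall>j<i. dotp (Suc i) (\<lambda>k. dotp n (u j) (v k)) c = 0"
    using homogeneous_solution[of i "Suc i" "\<lambda>j k. dotp n (u j) (v k)"] by auto
  define x where "x = (\<lambda>j. \<Sum>k\<le>i. c k * v k j)"
  have x: "0 < dotp n x x" "\<alpha> * dotp n x x \<le> dotp n x (mvec n a x)"
    using v[of c] c(1) unfolding x_def[symmetric] Let_def less_Suc_eq_le by auto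
  have "dotp n (u j) x = 0" if "j < i" for j
    using c(2) that unfolding x_def dotp_sum_right by (simp add: dotp_def[of "Suc i"] lessThan_Suc_atMost mult.commute)
  hence "dotp n x (mvec n a x) \<le> e i * dotp n x x" using u(3)[OF i] by blast
  hence "\<alpha> \<le> e i" using x by (meson mult_le_cancel_right_pos order_trans)
  thus ?thesis using lam_orthonormal_eigenbasis[OF u(1,2,4) i] by simp
qed

text \<open>Dual argument: the span of the first i + 1 eigenvectors contains a nonzero vector
  meeting the i constraints, and on that span the form is at least \<open>e i\<close> times the
  squared norm. The \<open>w j\<close> may coincide.\<close>

lemma lam_le_of_constraints:
  assumes sym: "symm n a" and i: "i < n"
    and w: "\<And>x. \<forall>j<i. dotp n (w j) x = 0 \<Longrightarrow> dotp n x (mvec n a x) \<le> \<alpha> * dotp n x x"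
  shows "lam (Matrix.mat n n (\<lambda>(i,j). a i j)) (Suc i) \<le> \<alpha>"
proof -
  obtain u e where u: "\<And>i j. i < n \<Longrightarrow> j < n \<Longrightarrow> dotp n (u i) (u j) = of_bool (i = j)"
    "\<And>i x. i < n \<Longrightarrow> x < n \<Longrightarrow> mvec n a (u i) x = e i * u i x"
    "\<And>i x. i < n \<Longrightarrow> (\<And>j. j < i \<Longrightarrow> dotp n (u j) x = 0) \<Longrightarrow> dotp n x (mvec n a x) \<le> e i * dotp n x x"
    "\<And>i j. i \<le> j \<Longrightarrow> j < n \<Longrightarrow> e j \<le> e i"
    using ordered_eigenbasis[OF sym] by blast
  obtain c where c: "\<exists>k<Suc i. c k \<noteq> 0" "\<forall>j<i. dotp (Suc i) (\<lambda>k. dotp n (w j) (u k)) c = 0"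
    using homogeneous_solution[of i "Suc i" "\<lambda>j k. dotp n (w j) (u k)"] by auto
  define x where "x = (\<lambda>j. \<Sum>k<Suc i. c k * u k j)"
  have Q: "dotp n x x = (\<Sum>k<Suc i. (c k)\<^sup>2)" "dotp n x (mvec n a x) = (\<Sum>k<Suc i. e k * (c k)\<^sup>2)"
    unfolding x_def using i by (intro quadratic_form_eigenvectors[OF u(1,2)]; simp)+
  have pos: "0 < dotp n x x"
  proof -
    obtain k where "k < Suc i" "c k \<noteq> 0" using c by blast
    thus ?thesis unfolding Q by (intro sum_pos2[of _ k]) auto
  qed
  have "dotp n (w j) x = 0" if "j < i" for j
    using c(2) that unfolding x_def dotp_sum_right by (simp add: dotp_def[of "Suc i"] mult.commute)
  hence "dotp n x (mvec n a x) \<le> \<alpha> * dotp n x x" using w by blast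
  moreover have "e i * dotp n x x \<le> dotp n x (mvec n a x)"
    unfolding Q sum_distrib_left using u(4) i by (intro sum_mono mult_right_mono) auto
  ultimately have "e i \<le> \<alpha>" using pos by (meson mult_le_cancel_right_pos order_trans)
  thus ?thesis using lam_orthonormal_eigenbasis[OF u(1,2,4) i] by simp
qed

section \<open>Expected trace of powers of the noise matrix\<close>

definition edge :: "nat \<Rightarrow> nat \<Rightarrow> nat \<times> nat" where
  "edge u v = (min u v, max u v)"

lemma edge_eq_iff: "edge a b = edge c d \<longleftrightarrow> a = c \<and> b = d \<or> a = d \<and> b = c"
  by (auto simp: edge_def min_def max_def)

lemma edge_commute: "edge a b = edge b a"
  by (simp add: edge_eq_iff)

text \<open>A walk is listed in reverse order, so that its current vertex is the head.\<close>

fun walk_edges :: "nat list \<Rightarrow> (nat \<times> nat) list" where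
  "walk_edges (x # y # ps) = edge x y # walk_edges (y # ps)"
| "walk_edges _ = []"

lemma walk_edges_Cons: "ps \<noteq> [] \<Longrightarrow> walk_edges (y # ps) = edge (hd ps) y # walk_edges ps"
  by (cases ps) (auto simp: edge_commute)

abbreviation traversals :: "nat list \<Rightarrow> nat \<times> nat \<Rightarrow> nat" where
  "traversals ps \<equiv> count_list (walk_edges ps)"

definition single_edges :: "nat list \<Rightarrow> (nat \<times> nat) set" where
  "single_edges ps = {e. traversals ps e = 1}"

definition single_degree :: "nat \<Rightarrow> nat list \<Rightarrow> nat \<Rightarrow> nat" where
  "single_degree n ps v = card {u. u < n \<and> u \<noteq> v \<and> traversals ps (edge v u) = 1}"

text \<open>
  For a walk that only creates new vertices and backtracks, the edges used once form a path ending at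
  the current vertex, so the degrees are at most 1 there and 2 elsewhere. The potential measures the
  excess over this; both subtractions are truncated.
\<close>

definition potential :: "nat \<Rightarrow> nat list \<Rightarrow> nat" where
  "potential n ps = (single_degree n ps (hd ps) - 1) +
     (\<Sum>v\<in>{..<n} - {hd ps}. single_degree n ps v - 2)"

text \<open>The noise matrix has zero diagonal, so walks with a loop carry no weight; without loops
  every traversed edge is one of the independent coordinates of the graph.\<close>

definition proper_walk :: "nat \<Rightarrow> nat list \<Rightarrow> bool" where
  "proper_walk n ps \<longleftrightarrow> ps \<noteq> [] \<and> set ps \<subseteq> {..<n} \<and> set (walk_edges ps) \<subseteq> node_pairs n"

lemma proper_walk_hd: "proper_walk n ps \<Longrightarrow> hd ps < n"
  using hd_in_set[of ps] by (force simp: proper_walk_def)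

lemma proper_walk_Cons:
  assumes "proper_walk n ps" "y < n" "y \<noteq> hd ps"
  shows "proper_walk n (y # ps)"
proof -
  have "hd ps < n" using assms(1) by (rule proper_walk_hd)
  thus ?thesis using assms
    by (auto simp: proper_walk_def walk_edges_Cons edge_def node_pairs_def min_def max_def)
qed

lemma edge_in_walk_vertices: "edge u v \<in> set (walk_edges ps) \<Longrightarrow> u \<in> set ps \<and> v \<in> set ps"
  by (induction ps rule: walk_edges.induct) (auto simp: edge_eq_iff)

lemma finite_single_edges: "finite (single_edges ps)"
proof (rule finite_subset)
  show "single_edges ps \<subseteq> set (walk_edges ps)"
  proof
    fix e assume "e \<in> single_edges ps"
    hence "traversals ps e \<noteq> 0" by (simp add: single_edges_def)
    thus "e \<in> set (walk_edges ps)" by (simp add: count_list_0_iff)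
  qed
qed simp

lemma single_degree_unvisited: "v \<notin> set ps \<Longrightarrow> single_degree n ps v = 0"
proof -
  assume "v \<notin> set ps"
  hence "traversals ps (edge v u) = 0" for u
    using edge_in_walk_vertices[of v u ps] by (auto simp: count_list_0_iff)
  thus ?thesis by (simp add: single_degree_def)
qed

lemma traversals_Cons: "ps \<noteq> [] \<Longrightarrow> traversals (y # ps) e = traversals ps e + of_bool (e = edge (hd ps) y)"
  by (simp add: walk_edges_Cons)

text \<open>The pair \<open>v\<close>, \<open>w\<close> stands for the two ends of the traversed
  edge in either order, so one statement serves both the vertex left and the vertex entered. A first
  use makes the edge single, a second ends this, later ones change nothing.\<close>

lemma single_degree_step:
  assumes "ps \<noteq> []" "y \<noteq> hd ps" and vw: "edge v w = edge (hd ps) y" "w < n"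
  shows "traversals ps (edge (hd ps) y) = 0 \<Longrightarrow> single_degree n (y # ps) v = single_degree n ps v + 1"
    "traversals ps (edge (hd ps) y) = 1 \<Longrightarrow> single_degree n ps v = single_degree n (y # ps) v + 1"
    "traversals ps (edge (hd ps) y) \<ge> 2 \<Longrightarrow> single_degree n (y # ps) v = single_degree n ps v"
proof -
  let ?S = "\<lambda>ps. {u. u < n \<and> u \<noteq> v \<and> traversals ps (edge v u) = 1}"
  have wv: "w \<noteq> v" using vw assms by (auto simp: edge_eq_iff)
  have tr: "traversals (y # ps) (edge v u) = traversals ps (edge v u) + of_bool (u = w)" for u
    using assms by (subst traversals_Cons) (auto simp: edge_eq_iff)
  have fin: "finite (?S ps)" for ps by simp
  show "single_degree n (y # ps) v = single_degree n ps v + 1" if "traversals ps (edge (hd ps) y) = 0"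
  proof -
    have "?S (y # ps) = insert w (?S ps)" "w \<notin> ?S ps"
      using that vw wv by (auto simp: tr)
    thus ?thesis using fin by (simp add: single_degree_def del: mem_Collect_eq)
  qed
  show "single_degree n ps v = single_degree n (y # ps) v + 1" if "traversals ps (edge (hd ps) y) = 1"
  proof -
    have "?S ps = insert w (?S (y # ps))" "w \<notin> ?S (y # ps)"
      using that vw wv by (auto simp: tr)
    thus ?thesis using fin by (simp add: single_degree_def del: mem_Collect_eq)
  qed
  show "single_degree n (y # ps) v = single_degree n ps v" if "traversals ps (edge (hd ps) y) \<ge> 2"
  proof -
    have "?S ps = ?S (y # ps)" using that vw wv by (auto simp: tr split: if_splits)
    thus ?thesis by (simp add: single_degree_def)
  qed
qed

lemma single_degree_step_other:
  assumes "ps \<noteq> []" "v \<noteq> hd ps" "v \<noteq> y"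
  shows "single_degree n (y # ps) v = single_degree n ps v"
  using assms by (simp add: single_degree_def traversals_Cons edge_eq_iff)

lemma potential_split:
  assumes "hd ps = x" "x < n" "y < n" "x \<noteq> y"
  shows "potential n ps = (single_degree n ps x - 1) + (single_degree n ps y - 2) +
    (\<Sum>v\<in>{..<n} - {x, y}. single_degree n ps v - 2)"
proof -
  have "{..<n} - {x} = insert y ({..<n} - {x, y})" using assms by auto
  thus ?thesis using assms by (simp add: potential_def)
qed

text \<open>The step raises the allowance of \<open>hd ps\<close> from 1 to 2 and lowers that of
  \<open>y\<close> from 2 to 1. A new edge therefore leaves the excess at \<open>hd ps\<close> and
  raises that at \<open>y\<close> by at most 2, or by nothing if \<open>y\<close> is unvisited. A
  second use leaves the excess at \<open>y\<close> and lowers that at \<open>hd ps\<close>, strictly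
  if its degree is at least 2. A further use costs at most 1, at \<open>y\<close>.\<close>

lemma potential_step:
  assumes "proper_walk n ps" and y: "y < n" "y \<noteq> hd ps"
  shows "traversals ps (edge (hd ps) y) = 0 \<Longrightarrow> potential n (y # ps) \<le> potential n ps + 2"
    "traversals ps (edge (hd ps) y) = 0 \<Longrightarrow> y \<notin> set ps \<Longrightarrow> potential n (y # ps) \<le> potential n ps"
    "traversals ps (edge (hd ps) y) = 1 \<Longrightarrow> potential n (y # ps) \<le> potential n ps"
    "traversals ps (edge (hd ps) y) = 1 \<Longrightarrow> single_degree n ps (hd ps) \<ge> 2 \<Longrightarrow>
       potential n (y # ps) + 1 \<le> potential n ps"
    "traversals ps (edge (hd ps) y) \<ge> 2 \<Longrightarrow> potential n (y # ps) \<le> potential n ps + 1"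
proof -
  let ?x = "hd ps"
  have ne: "ps \<noteq> []" using assms by (simp add: proper_walk_def)
  have x: "?x < n" using assms(1) by (rule proper_walk_hd)
  let ?R = "\<Sum>v\<in>{..<n} - {?x, y}. single_degree n ps v - 2"
  have R: "(\<Sum>v\<in>{..<n} - {y, ?x}. single_degree n (y # ps) v - 2) = ?R"
    using ne by (intro sum.cong) (auto simp: single_degree_step_other)
  have p: "potential n ps = (single_degree n ps ?x - 1) + (single_degree n ps y - 2) + ?R"
    using x y by (intro potential_split) auto
  have p': "potential n (y # ps) = (single_degree n (y # ps) y - 1) + (single_degree n (y # ps) ?x - 2) + ?R"
    unfolding R[symmetric] using x y by (intro potential_split) auto
  note dx = single_degree_step[OF ne y(2) refl y(1)]
  note dy = single_degree_step[OF ne y(2) edge_commute x]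
  show "traversals ps (edge (hd ps) y) = 0 \<Longrightarrow> potential n (y # ps) \<le> potential n ps + 2"
    using dx(1) dy(1) unfolding p p' by simp
  show "traversals ps (edge (hd ps) y) = 0 \<Longrightarrow> y \<notin> set ps \<Longrightarrow> potential n (y # ps) \<le> potential n ps"
    using dx(1) dy(1) single_degree_unvisited[of y ps n] unfolding p p' by simp
  show "traversals ps (edge (hd ps) y) = 1 \<Longrightarrow> potential n (y # ps) \<le> potential n ps"
    using dx(2) dy(2) unfolding p p' by simp
  show "traversals ps (edge (hd ps) y) = 1 \<Longrightarrow> single_degree n ps (hd ps) \<ge> 2 \<Longrightarrow>
       potential n (y # ps) + 1 \<le> potential n ps"
    using dx(2) dy(2) unfolding p p' by simp
  show "traversals ps (edge (hd ps) y) \<ge> 2 \<Longrightarrow> potential n (y # ps) \<le> potential n ps + 1"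
    using dx(3) dy(3) unfolding p p' by simp
qed

lemma card_edges_step:
  assumes "ps \<noteq> []"
  shows "traversals ps (edge (hd ps) y) = 0 \<Longrightarrow>
      card (set (walk_edges (y # ps))) = card (set (walk_edges ps)) + 1"
    "traversals ps (edge (hd ps) y) \<noteq> 0 \<Longrightarrow>
      card (set (walk_edges (y # ps))) = card (set (walk_edges ps))"
  using assms by (simp_all add: walk_edges_Cons count_list_0_iff insert_absorb)

lemma card_single_edges_step:
  assumes "ps \<noteq> []"
  shows "traversals ps (edge (hd ps) y) = 0 \<Longrightarrow> card (single_edges (y # ps)) = card (single_edges ps) + 1"
    "traversals ps (edge (hd ps) y) = 1 \<Longrightarrow> card (single_edges ps) = card (single_edges (y # ps)) + 1"
    "traversals ps (edge (hd ps) y) \<ge> 2 \<Longrightarrow> card (single_edges (y # ps)) = card (single_edges ps)"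
proof -
  let ?e = "edge (hd ps) y"
  note tr = traversals_Cons[OF assms, of y]
  show "card (single_edges (y # ps)) = card (single_edges ps) + 1" if "traversals ps ?e = 0"
  proof -
    have "single_edges (y # ps) = insert ?e (single_edges ps)" "?e \<notin> single_edges ps"
      using that by (auto simp: single_edges_def tr)
    thus ?thesis by (simp add: finite_single_edges)
  qed
  show "card (single_edges ps) = card (single_edges (y # ps)) + 1" if "traversals ps ?e = 1"
  proof -
    have "single_edges ps = insert ?e (single_edges (y # ps))" "?e \<notin> single_edges (y # ps)"
      using that by (auto simp: single_edges_def tr)
    thus ?thesis by (simp add: finite_single_edges)
  qed
  show "card (single_edges (y # ps)) = card (single_edges ps)" if "traversals ps ?e \<ge> 2"
  proof -
    have "single_edges (y # ps) = single_edges ps"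
      using that by (auto simp: single_edges_def tr split: if_splits)
    thus ?thesis by simp
  qed
qed

text \<open>
  Each step multiplies the bound by 4 s in total, one s for each of the four kinds of step:
  new vertex, new edge between old vertices, edge used once, edge used more than once.
\<close>

definition walk_bound :: "nat \<Rightarrow> real \<Rightarrow> real \<Rightarrow> nat \<Rightarrow> nat \<Rightarrow> nat list \<Rightarrow> real" where
  "walk_bound n v s L m ps =
     v ^ card (set (walk_edges ps)) * (4 * s) ^ m / s ^ card (single_edges ps) * real L ^ potential n ps"

lemma sum_walk_bound_le:
  assumes ps: "proper_walk n ps" "length ps \<le> L"
    and v: "0 \<le> v" "v \<le> 1" and s: "0 < s" "s\<^sup>2 = real n * v" "(real L)\<^sup>2 \<le> s"
  shows "(\<Sum>y\<in>{..<n} - {hd ps}. walk_bound n v s L m (y # ps)) \<le> walk_bound n v s L (Suc m) ps"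
proof -
  let ?x = "hd ps" and ?t = "\<lambda>y. traversals ps (edge (hd ps) y)" and ?L = "real L"
  have ne: "ps \<noteq> []" using ps by (simp add: proper_walk_def)
  hence L: "?L \<ge> 1" using ps(2) by (cases ps) auto
  have cs: "card (set ps) \<le> L" using ps(2) card_length[of ps] by simp
  define N h \<Phi> where "N = card (set (walk_edges ps))" and "h = card (single_edges ps)" and "\<Phi> = potential n ps"
  \<comment> \<open>\<open>G\<close> is the bound for \<open>ps\<close> with only \<open>m\<close>
    steps left; the sum has to be at most 4 s G.\<close>
  define G where "G = v ^ N * (4 * s) ^ m / s ^ h * ?L ^ \<Phi>"
  have G: "G \<ge> 0" using v s L by (simp add: G_def)
  have visited: "y \<in> set ps" if "?t y \<noteq> 0" for y
    using that edge_in_walk_vertices[of ?x y ps] by (auto simp: count_list_0_iff)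
  have Lpow: "?L ^ a \<le> ?L ^ b" if "a \<le> b" for a b using that L by (rule power_increasing)
  define SA where "SA = {y\<in>{..<n} - {?x}. ?t y = 0 \<and> y \<notin> set ps}"
  define SB where "SB = {y\<in>{..<n} - {?x}. ?t y = 0 \<and> y \<in> set ps}"
  define SC where "SC = {y\<in>{..<n} - {?x}. ?t y = 1}"
  define SD where "SD = {y\<in>{..<n} - {?x}. ?t y \<ge> 2}"
  have cardL: "real (card S) \<le> ?L" if "S \<subseteq> set ps" for S
    using card_mono[OF _ that] cs by simp
  \<comment> \<open>At most n new vertices, each with a factor v for the new edge and 1 / s for its
    being single: n v / s = s.\<close>
  have A: "(\<Sum>y\<in>SA. walk_bound n v s L m (y # ps)) \<le> s * G"
  proof -
    have "walk_bound n v s L m (y # ps) \<le> v / s * G" if "y \<in> SA" for y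
    proof -
      have y: "y < n" "y \<noteq> ?x" "?t y = 0" "y \<notin> set ps" using that by (auto simp: SA_def)
      have "?L ^ potential n (y # ps) \<le> ?L ^ \<Phi>"
        unfolding \<Phi>_def by (intro Lpow potential_step(2)) (use ps y in auto)
      hence "walk_bound n v s L m (y # ps) \<le> v ^ (N + 1) * (4 * s) ^ m / s ^ (h + 1) * ?L ^ \<Phi>"
        unfolding walk_bound_def card_edges_step(1)[OF ne y(3)] card_single_edges_step(1)[OF ne y(3)]
          N_def[symmetric] h_def[symmetric] using v s by (intro mult_left_mono) auto
      thus ?thesis by (simp add: G_def)
    qed
    hence "(\<Sum>y\<in>SA. walk_bound n v s L m (y # ps)) \<le> (\<Sum>y\<in>SA. v / s * G)" by (rule sum_mono)
    also have "\<dots> = real (card SA) * (v / s * G)" by simp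
    also have "\<dots> \<le> real n * (v / s * G)"
      using card_mono[of "{..<n}" SA] v s G by (intro mult_right_mono) (auto simp: SA_def)
    also have "\<dots> = s * G" using s(1) s(2)[symmetric] by (simp add: power2_eq_square field_simps)
    finally show ?thesis .
  qed
  \<comment> \<open>At most L visited vertices, a factor 1 / s, and a potential that may rise by 2:
    L^3 / s \<le> L^4 / s \<le> s. The factor v is bounded by 1.\<close>
  have B: "(\<Sum>y\<in>SB. walk_bound n v s L m (y # ps)) \<le> s * G"
  proof -
    have "walk_bound n v s L m (y # ps) \<le> ?L\<^sup>2 / s * G" if "y \<in> SB" for y
    proof -
      have y: "y < n" "y \<noteq> ?x" "?t y = 0" using that by (auto simp: SB_def)
      have "?L ^ potential n (y # ps) \<le> ?L ^ (\<Phi> + 2)"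
        unfolding \<Phi>_def by (intro Lpow potential_step(1)) (use ps y in auto)
      hence "walk_bound n v s L m (y # ps) \<le> v ^ (N + 1) * (4 * s) ^ m / s ^ (h + 1) * ?L ^ (\<Phi> + 2)"
        unfolding walk_bound_def card_edges_step(1)[OF ne y(3)] card_single_edges_step(1)[OF ne y(3)]
          N_def[symmetric] h_def[symmetric] using v s by (intro mult_left_mono) auto
      also have "\<dots> = v * (?L\<^sup>2 / s * G)" by (simp add: G_def power2_eq_square)
      also have "\<dots> \<le> 1 * (?L\<^sup>2 / s * G)" using v s G by (intro mult_right_mono) auto
      finally show ?thesis by simp
    qed
    hence "(\<Sum>y\<in>SB. walk_bound n v s L m (y # ps)) \<le> (\<Sum>y\<in>SB. ?L\<^sup>2 / s * G)" by (rule sum_mono)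
    also have "\<dots> = real (card SB) * (?L\<^sup>2 / s * G)" by simp
    also have "\<dots> \<le> ?L * (?L\<^sup>2 / s * G)"
      using s G by (intro mult_right_mono cardL) (auto simp: SB_def)
    also have "\<dots> \<le> ?L\<^sup>2 * (?L\<^sup>2 / s * G)"
      using s G L self_le_power[of ?L 2] by (intro mult_right_mono) auto
    also have "\<dots> \<le> s * (s / s * G)"
      using s G by (intro mult_mono divide_right_mono) auto
    finally show ?thesis using s by simp
  qed
  \<comment> \<open>The second use of an edge releases the s stored in the denominator. Either there
    is at most one such edge at the current vertex, or the drop of the potential gives a factor 1 /
    L against at most L choices.\<close>
  have C: "(\<Sum>y\<in>SC. walk_bound n v s L m (y # ps)) \<le> s * G"
  proof -
    have wb: "walk_bound n v s L m (y # ps) = s * (v ^ N * (4 * s) ^ m / s ^ h) * ?L ^ potential n (y # ps)"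
      if "y \<in> SC" for y
    proof -
      have y: "?t y = 1" using that by (auto simp: SC_def)
      have "s ^ h = s * s ^ card (single_edges (y # ps))"
        using card_single_edges_step(2)[OF ne y] by (simp add: h_def)
      thus ?thesis using card_edges_step(2)[OF ne, of y] y s
        by (simp add: walk_bound_def N_def)
    qed
    have card: "card SC = single_degree n ps ?x"
      unfolding single_degree_def SC_def by (rule arg_cong[of _ _ card]) auto
    show ?thesis
    proof (cases "single_degree n ps ?x \<ge> 2")
      case True
      have "walk_bound n v s L m (y # ps) \<le> s * G / ?L" if "y \<in> SC" for y
      proof -
        have y: "y < n" "y \<noteq> ?x" "?t y = 1" using that by (auto simp: SC_def)
        have "?L ^ (potential n (y # ps) + 1) \<le> ?L ^ \<Phi>"
          unfolding \<Phi>_def by (intro Lpow potential_step(4)) (use ps y True in auto)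
        hence "?L ^ potential n (y # ps) \<le> ?L ^ \<Phi> / ?L" using L by (simp add: field_simps)
        hence "walk_bound n v s L m (y # ps) \<le> s * (v ^ N * (4 * s) ^ m / s ^ h) * (?L ^ \<Phi> / ?L)"
          unfolding wb[OF that] using v s by (intro mult_left_mono) auto
        thus ?thesis by (simp add: G_def)
      qed
      hence "(\<Sum>y\<in>SC. walk_bound n v s L m (y # ps)) \<le> (\<Sum>y\<in>SC. s * G / ?L)" by (rule sum_mono)
      also have "\<dots> = real (card SC) * (s * G / ?L)" by simp
      also have "\<dots> \<le> ?L * (s * G / ?L)"
        using s G L visited by (intro mult_right_mono cardL) (auto simp: SC_def)
      finally show ?thesis using L by simp
    next
      case False
      have "walk_bound n v s L m (y # ps) \<le> s * G" if "y \<in> SC" for y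
      proof -
        have y: "y < n" "y \<noteq> ?x" "?t y = 1" using that by (auto simp: SC_def)
        have "?L ^ potential n (y # ps) \<le> ?L ^ \<Phi>"
          unfolding \<Phi>_def by (intro Lpow potential_step(3)) (use ps y in auto)
        hence "walk_bound n v s L m (y # ps) \<le> s * (v ^ N * (4 * s) ^ m / s ^ h) * ?L ^ \<Phi>"
          unfolding wb[OF that] using v s by (intro mult_left_mono) auto
        thus ?thesis by (simp add: G_def)
      qed
      hence "(\<Sum>y\<in>SC. walk_bound n v s L m (y # ps)) \<le> (\<Sum>y\<in>SC. s * G)" by (rule sum_mono)
      also have "\<dots> = real (card SC) * (s * G)" by simp
      also have "\<dots> \<le> 1 * (s * G)"
        using s G card False by (intro mult_right_mono) auto
      finally show ?thesis by simp
    qed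
  qed
  \<comment> \<open>At most L choices, each raising the potential by at most 1: L^2 \<le> s.\<close>
  have D: "(\<Sum>y\<in>SD. walk_bound n v s L m (y # ps)) \<le> s * G"
  proof -
    have "walk_bound n v s L m (y # ps) \<le> ?L * G" if "y \<in> SD" for y
    proof -
      have y: "y < n" "y \<noteq> ?x" "?t y \<ge> 2" using that by (auto simp: SD_def)
      have "?L ^ potential n (y # ps) \<le> ?L ^ (\<Phi> + 1)"
        unfolding \<Phi>_def by (intro Lpow potential_step(5)) (use ps y in auto)
      moreover have "card (set (walk_edges (y # ps))) = N"
        unfolding N_def by (rule card_edges_step(2)[OF ne]) (use y in auto)
      ultimately have "walk_bound n v s L m (y # ps) \<le> v ^ N * (4 * s) ^ m / s ^ h * ?L ^ (\<Phi> + 1)"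
        unfolding walk_bound_def card_single_edges_step(3)[OF ne y(3)] h_def[symmetric]
        using v s by (intro mult_mono) auto
      thus ?thesis by (simp add: G_def mult_ac)
    qed
    hence "(\<Sum>y\<in>SD. walk_bound n v s L m (y # ps)) \<le> (\<Sum>y\<in>SD. ?L * G)" by (rule sum_mono)
    also have "\<dots> = real (card SD) * (?L * G)" by simp
    also have "\<dots> \<le> ?L * (?L * G)"
      using L G visited by (intro mult_right_mono cardL) (auto simp: SD_def)
    also have "\<dots> = ?L\<^sup>2 * G" by (simp add: power2_eq_square)
    also have "\<dots> \<le> s * G" using s G by (intro mult_right_mono) auto
    finally show ?thesis .
  qed
  have un: "{..<n} - {?x} = SA \<union> (SB \<union> (SC \<union> SD))"
    by (auto simp: SA_def SB_def SC_def SD_def)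
  have fin: "finite SA" "finite SB" "finite SC" "finite SD"
    by (auto simp: SA_def SB_def SC_def SD_def)
  have disj: "SA \<inter> (SB \<union> (SC \<union> SD)) = {}" "SB \<inter> (SC \<union> SD) = {}" "SC \<inter> SD = {}"
    by (auto simp: SA_def SB_def SC_def SD_def)
  have "(\<Sum>y\<in>{..<n} - {?x}. walk_bound n v s L m (y # ps)) \<le> 4 * (s * G)"
    unfolding un using fin disj A B C D by (simp add: sum.union_disjoint)
  also have "\<dots> = walk_bound n v s L (Suc m) ps"
    by (simp add: walk_bound_def G_def N_def h_def \<Phi>_def)
  finally show ?thesis .
qed

section \<open>Moments of walk weights\<close>

text \<open>The recursion splits off the first step, so \<open>matpow n a m (hd ps) j\<close> is the
  total weight of the continuations of the walk \<open>ps\<close> by \<open>m\<close> steps ending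
  in \<open>j\<close>.\<close>

fun matpow :: "nat \<Rightarrow> (nat \<Rightarrow> nat \<Rightarrow> real) \<Rightarrow> nat \<Rightarrow> nat \<Rightarrow> nat \<Rightarrow> real" where
  "matpow n a 0 i j = of_bool (i = j)"
| "matpow n a (Suc m) i j = (\<Sum>y<n. a i y * matpow n a m y j)"

definition noise :: "(nat \<times> nat \<Rightarrow> real) \<Rightarrow> (nat \<times> nat \<Rightarrow> bool) \<Rightarrow> nat \<Rightarrow> nat \<Rightarrow> real" where
  "noise pr E i j = (if i = j then 0 else of_bool (E (edge i j)) - pr (edge i j))"

definition random_graph :: "nat \<Rightarrow> (nat \<times> nat \<Rightarrow> real) \<Rightarrow> (nat \<times> nat \<Rightarrow> bool) pmf" where
  "random_graph n pr = Pi_pmf (node_pairs n) False (\<lambda>e. bernoulli_pmf (pr e))"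

lemma finite_node_pairs: "finite (node_pairs n)"
  by (rule finite_subset[of _ "{..<n} \<times> {..<n}"]) (auto simp: node_pairs_def)

lemma integrable_random_graph: "integrable (measure_pmf (random_graph n pr)) (f :: _ \<Rightarrow> real)"
proof (rule integrable_measure_pmf_finite)
  have "finite (PiE_dflt (node_pairs n) False (\<lambda>_. UNIV :: bool set))"
    using finite_node_pairs by (intro finite_PiE_dflt) auto
  thus "finite (set_pmf (random_graph n pr))"
    unfolding random_graph_def set_Pi_pmf[OF finite_node_pairs]
    by (rule finite_subset[rotated]) (auto simp: PiE_dflt_def)
qed

lemma expectation_prod_random_graph:
  fixes f :: "nat \<times> nat \<Rightarrow> bool \<Rightarrow> real"
  shows "measure_pmf.expectation (random_graph n pr) (\<lambda>E. \<Prod>e\<in>node_pairs n. f e (E e)) =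
    (\<Prod>e\<in>node_pairs n. measure_pmf.expectation (bernoulli_pmf (pr e)) (f e))"
proof -
  let ?D = "random_graph n pr"
  have "prob_space.indep_vars (measure_pmf ?D) (\<lambda>_. count_space UNIV) (\<lambda>x f. f x) (node_pairs n)"
    unfolding random_graph_def by (rule indep_vars_Pi_pmf[OF finite_node_pairs])
  hence ind: "prob_space.indep_vars (measure_pmf ?D) (\<lambda>_. borel) (\<lambda>e E. f e (E e)) (node_pairs n)"
    by (rule prob_space.indep_vars_compose2[OF prob_space_measure_pmf]) auto
  have "measure_pmf.expectation ?D (\<lambda>E. \<Prod>e\<in>node_pairs n. f e (E e)) =
    (\<Prod>e\<in>node_pairs n. measure_pmf.expectation ?D (\<lambda>E. f e (E e)))"
    by (rule prob_space.indep_vars_lebesgue_integral[OF prob_space_measure_pmf finite_node_pairs ind]) (rule integrable_random_graph)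
  also have "\<dots> = (\<Prod>e\<in>node_pairs n. measure_pmf.expectation (bernoulli_pmf (pr e)) (f e))"
  proof (intro prod.cong refl)
    fix e assume "e \<in> node_pairs n"
    hence "map_pmf (\<lambda>E. E e) ?D = bernoulli_pmf (pr e)"
      unfolding random_graph_def by (subst Pi_pmf_component[OF finite_node_pairs]) simp
    hence "measure_pmf.expectation (bernoulli_pmf (pr e)) (f e) = measure_pmf.expectation (map_pmf (\<lambda>E. E e) ?D) (f e)"
      by simp
    thus "measure_pmf.expectation ?D (\<lambda>E. f e (E e)) = measure_pmf.expectation (bernoulli_pmf (pr e)) (f e)"
      by simp
  qed
  finally show ?thesis .
qed

text \<open>The centred variable is at most 1 in absolute value, so its higher moments are dominated
  by the variance.\<close>

lemma bernoulli_centred_moment: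
  fixes a :: real
  assumes "0 \<le> a" "a \<le> 1"
  shows "measure_pmf.expectation (bernoulli_pmf a) (\<lambda>b. (of_bool b - a) ^ 1) = 0"
    "c \<ge> 2 \<Longrightarrow> \<bar>measure_pmf.expectation (bernoulli_pmf a) (\<lambda>b. (of_bool b - a) ^ c)\<bar> \<le> a * (1 - a)"
proof -
  show "measure_pmf.expectation (bernoulli_pmf a) (\<lambda>b. (of_bool b - a) ^ 1) = 0"
    using assms by (simp add: algebra_simps)
  assume c: "c \<ge> 2"
  have "\<bar>(1 - a) ^ c * a + (- a) ^ c * (1 - a)\<bar> \<le> \<bar>(1 - a) ^ c * a\<bar> + \<bar>(- a) ^ c * (1 - a)\<bar>"
    by (rule abs_triangle_ineq)
  also have "\<dots> = (1 - a) ^ c * a + a ^ c * (1 - a)"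
    using assms by (simp add: abs_mult power_abs)
  also have "\<dots> \<le> (1 - a) ^ 2 * a + a ^ 2 * (1 - a)"
    using assms c by (intro add_mono mult_right_mono power_decreasing) auto
  also have "\<dots> = a * (1 - a)" by (simp add: power2_eq_square algebra_simps)
  finally show "\<bar>measure_pmf.expectation (bernoulli_pmf a) (\<lambda>b. (of_bool b - a) ^ c)\<bar> \<le> a * (1 - a)"
    using assms by (simp add: algebra_simps)
qed

lemma prod_list_map_count_list:
  fixes f :: "'a \<Rightarrow> real"
  assumes "finite A" "set xs \<subseteq> A"
  shows "prod_list (map f xs) = (\<Prod>x\<in>A. f x ^ count_list xs x)"
  using assms(2)
proof (induction xs)
  case (Cons x xs)
  have "(\<Prod>z\<in>A. f z ^ count_list (x # xs) z) = (\<Prod>z\<in>A. (if z = x then f z else 1) * f z ^ count_list xs z)"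
    by (intro prod.cong) auto
  also have "\<dots> = (\<Prod>z\<in>A. if z = x then f z else 1) * (\<Prod>z\<in>A. f z ^ count_list xs z)" by (rule prod.distrib)
  also have "(\<Prod>z\<in>A. if z = x then f z else 1) = f x" using Cons.prems assms(1) by simp
  finally show ?case using Cons by simp
qed simp

definition walk_weight :: "(nat \<times> nat \<Rightarrow> real) \<Rightarrow> (nat \<times> nat \<Rightarrow> bool) \<Rightarrow> nat list \<Rightarrow> real" where
  "walk_weight pr E ps = (\<Prod>e\<leftarrow>walk_edges ps. of_bool (E e) - pr e)"

lemma expectation_walk_weight:
  assumes pr: "\<And>e. 0 \<le> pr e \<and> pr e \<le> 1 \<and> pr e * (1 - pr e) \<le> v" and "set (walk_edges ps) \<subseteq> node_pairs n"
  shows "\<bar>measure_pmf.expectation (random_graph n pr) (\<lambda>E. walk_weight pr E ps)\<bar> \<le>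
    (if single_edges ps = {} then v ^ card (set (walk_edges ps)) else 0)"
proof -
  let ?m = "\<lambda>e. measure_pmf.expectation (bernoulli_pmf (pr e)) (\<lambda>b. (of_bool b - pr e) ^ traversals ps e)"
  have "measure_pmf.expectation (random_graph n pr) (\<lambda>E. walk_weight pr E ps) = (\<Prod>e\<in>node_pairs n. ?m e)"
    unfolding walk_weight_def prod_list_map_count_list[OF finite_node_pairs assms(2)]
    by (rule expectation_prod_random_graph)
  hence abs: "\<bar>measure_pmf.expectation (random_graph n pr) (\<lambda>E. walk_weight pr E ps)\<bar> = (\<Prod>e\<in>node_pairs n. \<bar>?m e\<bar>)"
    by (simp add: abs_prod)
  show ?thesis
  proof (cases "single_edges ps = {}")
    case True
    have "(\<Prod>e\<in>node_pairs n. \<bar>?m e\<bar>) \<le> (\<Prod>e\<in>node_pairs n. if e \<in> set (walk_edges ps) then v else 1)"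
    proof (intro prod_mono conjI)
      fix e
      show "\<bar>?m e\<bar> \<le> (if e \<in> set (walk_edges ps) then v else 1)"
      proof (cases "e \<in> set (walk_edges ps)")
        case False
        hence "traversals ps e = 0" by (simp add: count_list_0_iff)
        thus ?thesis using False by simp
      next
        case t: True
        hence "traversals ps e \<noteq> 0" "traversals ps e \<noteq> 1"
          using True unfolding single_edges_def by (simp add: count_list_0_iff, blast)
        hence "traversals ps e \<ge> 2" by simp
        hence "\<bar>?m e\<bar> \<le> pr e * (1 - pr e)" using pr[of e] by (intro bernoulli_centred_moment(2)) auto
        thus ?thesis using t pr[of e] by auto
      qed
    qed simp
    also have "\<dots> = v ^ card (set (walk_edges ps))"
    proof -
      have "node_pairs n \<inter> {e. e \<in> set (walk_edges ps)} = set (walk_edges ps)" using assms(2) by auto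
      thus ?thesis using prod.If_cases[OF finite_node_pairs, of "\<lambda>e. e \<in> set (walk_edges ps)" "\<lambda>_. v" "\<lambda>_. 1"]
        by simp
    qed
    finally show ?thesis using True abs by simp
  next
    case False
    then obtain e where e: "traversals ps e = 1" by (auto simp: single_edges_def)
    hence "e \<in> node_pairs n" using assms(2) by (metis count_list_0_iff subsetD zero_neq_one)
    moreover have "?m e = 0" unfolding e using pr[of e] by (intro bernoulli_centred_moment(1)) auto
    ultimately have "(\<Prod>e\<in>node_pairs n. \<bar>?m e\<bar>) = 0"
      by (intro prod_zero finite_node_pairs) force
    thus ?thesis unfolding abs using False by simp
  qed
qed

text \<open>Expanding the first remaining step turns the quantity for \<open>ps\<close> into the sum
  of those for \<open>y # ps\<close>, which \<open>sum_walk_bound_le\<close> estimates.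
  \<open>L\<close> can stay fixed because \<open>length ps + m\<close> does not change.\<close>

lemma expectation_walk_continuation:
  assumes pr: "\<And>e. 0 \<le> pr e \<and> pr e \<le> 1 \<and> pr e * (1 - pr e) \<le> v"
    and v: "v \<le> 1" and s: "0 < s" "s\<^sup>2 = real n * v" "(real L)\<^sup>2 \<le> s"
    and ps: "proper_walk n ps" "length ps + m \<le> L"
  shows "\<bar>measure_pmf.expectation (random_graph n pr) (\<lambda>E. walk_weight pr E ps * matpow n (noise pr E) m (hd ps) j)\<bar>
    \<le> walk_bound n v s L m ps"
  using ps
proof (induction m arbitrary: ps)
  case 0
  have v0: "0 \<le> v" using pr[of undefined] by (smt (verit) mult_nonneg_nonneg)
  have L: "real L \<ge> 1" using 0 by (cases ps) (auto simp: proper_walk_def)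
  \<comment> \<open>With no steps left the last factor is the deterministic indicator of ending in
    \<open>j\<close>, bounded by 1.\<close>
  have "\<bar>measure_pmf.expectation (random_graph n pr) (\<lambda>E. walk_weight pr E ps * matpow n (noise pr E) 0 (hd ps) j)\<bar>
    \<le> \<bar>measure_pmf.expectation (random_graph n pr) (\<lambda>E. walk_weight pr E ps)\<bar>"
    by simp
  also have "\<dots> \<le> (if single_edges ps = {} then v ^ card (set (walk_edges ps)) else 0)"
    using 0 pr by (intro expectation_walk_weight) (auto simp: proper_walk_def)
  \<comment> \<open>A leftover single edge makes the expectation 0; otherwise the powers of s are 1
    and the power of L is at least 1.\<close>
  also have "\<dots> \<le> walk_bound n v s L 0 ps"
  proof (cases "single_edges ps = {}")
    case True
    have "v ^ card (set (walk_edges ps)) * 1 \<le> v ^ card (set (walk_edges ps)) * real L ^ potential n ps"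
      using v0 L by (intro mult_left_mono one_le_power) auto
    thus ?thesis using True by (simp add: walk_bound_def)
  next
    case False
    thus ?thesis using v0 s by (simp add: walk_bound_def)
  qed
  finally show ?case .
next
  case (Suc m)
  have v0: "0 \<le> v" using pr[of undefined] by (smt (verit) mult_nonneg_nonneg)
  let ?E = "measure_pmf.expectation (random_graph n pr)"
  have ne: "ps \<noteq> []" using Suc.prems by (simp add: proper_walk_def)
  have x: "hd ps < n" using Suc.prems(1) by (rule proper_walk_hd)
  have eq: "walk_weight pr E ps * matpow n (noise pr E) (Suc m) (hd ps) j =
    (\<Sum>y\<in>{..<n} - {hd ps}. walk_weight pr E (y # ps) * matpow n (noise pr E) m y j)" for E
  proof -
    have "walk_weight pr E ps * matpow n (noise pr E) (Suc m) (hd ps) j =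
      (\<Sum>y<n. walk_weight pr E ps * (noise pr E (hd ps) y * matpow n (noise pr E) m y j))"
      by (simp add: sum_distrib_left)
    also have "\<dots> = (\<Sum>y\<in>{..<n} - {hd ps}. walk_weight pr E ps * (noise pr E (hd ps) y * matpow n (noise pr E) m y j))"
      using x by (subst sum.remove[of _ "hd ps"]) (auto simp: noise_def)
    also have "\<dots> = (\<Sum>y\<in>{..<n} - {hd ps}. walk_weight pr E (y # ps) * matpow n (noise pr E) m y j)"
      by (intro sum.cong) (auto simp: noise_def walk_weight_def walk_edges_Cons[OF ne])
    finally show ?thesis .
  qed
  have "\<bar>?E (\<lambda>E. walk_weight pr E ps * matpow n (noise pr E) (Suc m) (hd ps) j)\<bar> =
    \<bar>\<Sum>y\<in>{..<n} - {hd ps}. ?E (\<lambda>E. walk_weight pr E (y # ps) * matpow n (noise pr E) m y j)\<bar>"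
    unfolding eq by (subst Bochner_Integration.integral_sum) (auto intro: integrable_random_graph)
  also have "\<dots> \<le> (\<Sum>y\<in>{..<n} - {hd ps}. \<bar>?E (\<lambda>E. walk_weight pr E (y # ps) * matpow n (noise pr E) m y j)\<bar>)"
    by (rule sum_abs)
  also have "\<dots> \<le> (\<Sum>y\<in>{..<n} - {hd ps}. walk_bound n v s L m (y # ps))"
  proof (intro sum_mono)
    fix y assume "y \<in> {..<n} - {hd ps}"
    hence "proper_walk n (y # ps)" using Suc.prems by (intro proper_walk_Cons) auto
    thus "\<bar>?E (\<lambda>E. walk_weight pr E (y # ps) * matpow n (noise pr E) m y j)\<bar> \<le> walk_bound n v s L m (y # ps)"
      using Suc.IH[of "y # ps"] Suc.prems by simp
  qed
  also have "\<dots> \<le> walk_bound n v s L (Suc m) ps"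
    using Suc.prems v0 v s by (intro sum_walk_bound_le) auto
  finally show ?case .
qed

text \<open>Walks start from the prefix \<open>[i]\<close>, where no edge is used and the potential
  is 0, so the bound is just (4 s)^m. \<open>L\<close> becomes \<open>Suc m\<close>, the number of
  vertices listed by a walk of m steps.\<close>

lemma expectation_trace_power:
  assumes pr: "\<And>e. 0 \<le> pr e \<and> pr e \<le> 1 \<and> pr e * (1 - pr e) \<le> v"
    and v: "v \<le> 1" and s: "0 < s" "s\<^sup>2 = real n * v" "(real (Suc m))\<^sup>2 \<le> s"
  shows "measure_pmf.expectation (random_graph n pr) (\<lambda>E. \<Sum>i<n. matpow n (noise pr E) m i i) \<le> real n * (4 * s) ^ m"
proof -
  let ?E = "measure_pmf.expectation (random_graph n pr)"
  have "?E (\<lambda>E. \<Sum>i<n. matpow n (noise pr E) m i i) = (\<Sum>i<n. ?E (\<lambda>E. matpow n (noise pr E) m i i))"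
    by (subst Bochner_Integration.integral_sum) (auto intro: integrable_random_graph)
  also have "\<dots> \<le> (\<Sum>i<n. (4 * s) ^ m)"
  proof (intro sum_mono)
    fix i assume i: "i \<in> {..<n}"
    have "\<bar>?E (\<lambda>E. walk_weight pr E [i] * matpow n (noise pr E) m (hd [i]) i)\<bar> \<le> walk_bound n v s (Suc m) m [i]"
      using i by (intro expectation_walk_continuation[OF pr v s]) (auto simp: proper_walk_def)
    moreover have "walk_bound n v s (Suc m) m [i] = (4 * s) ^ m"
      by (simp add: walk_bound_def single_edges_def potential_def single_degree_def)
    ultimately show "?E (\<lambda>E. matpow n (noise pr E) m i i) \<le> (4 * s) ^ m"
      by (simp add: walk_weight_def)
  qed
  finally show ?thesis by simp
qed

section \<open>Norm of the noise matrix\<close>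

lemma matpow_add:
  assumes "i < n"
  shows "matpow n a (k + l) i j = (\<Sum>y<n. matpow n a k i y * matpow n a l y j)"
  using assms
proof (induction k arbitrary: i)
  case 0
  have "(\<Sum>y<n. matpow n a 0 i y * matpow n a l y j) = (\<Sum>y<n. if y = i then matpow n a l y j else 0)"
    by (intro sum.cong) auto
  thus ?case using 0 by simp
next
  case (Suc k)
  have "matpow n a (Suc k + l) i j = (\<Sum>z<n. \<Sum>y<n. a i z * (matpow n a k z y * matpow n a l y j))"
    using Suc.IH by (simp add: sum_distrib_left)
  also have "\<dots> = (\<Sum>y<n. \<Sum>z<n. a i z * (matpow n a k z y * matpow n a l y j))" by (rule sum.swap)
  also have "\<dots> = (\<Sum>y<n. matpow n a (Suc k) i y * matpow n a l y j)"
    by (simp add: sum_distrib_right mult.assoc)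
  finally show ?case .
qed

lemma matpow_symm:
  assumes "symm n a" "i < n" "j < n"
  shows "matpow n a k i j = matpow n a k j i"
  using assms(2,3)
proof (induction k arbitrary: i j)
  case (Suc k)
  have one: "matpow n a 1 y i = a y i" for y
  proof -
    have "matpow n a 1 y i = (\<Sum>z<n. if z = i then a y z else 0)"
      by (simp only: One_nat_def matpow.simps) (intro sum.cong, auto)
    thus ?thesis using Suc.prems by simp
  qed
  have "matpow n a (Suc k) i j = (\<Sum>y<n. matpow n a k j y * matpow n a 1 y i)"
    unfolding one using Suc assms(1) by (auto simp: symm_def intro!: sum.cong)
  also have "\<dots> = matpow n a (k + 1) j i" using Suc.prems by (intro matpow_add[symmetric])
  finally show ?case by simp
qed auto

text \<open>An even power makes the trace a squared Frobenius norm: nonnegative, as Markov's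
  inequality needs, and an upper bound for the squared operator norm of the k-th power.\<close>

lemma trace_matpow_double:
  assumes "symm n a"
  shows "(\<Sum>i<n. matpow n a (2 * k) i i) = (\<Sum>i<n. \<Sum>j<n. (matpow n a k i j)\<^sup>2)"
proof (intro sum.cong refl)
  fix i assume i: "i \<in> {..<n}"
  have "matpow n a (2 * k) i i = (\<Sum>y<n. matpow n a k i y * matpow n a k y i)"
    using matpow_add[of i n a k k i] i by (simp add: mult_2)
  also have "\<dots> = (\<Sum>y<n. (matpow n a k i y)\<^sup>2)"
    using matpow_symm[OF assms] i by (intro sum.cong) (auto simp: power2_eq_square)
  finally show "matpow n a (2 * k) i i = (\<Sum>j<n. (matpow n a k i j)\<^sup>2)" .
qed

lemma mvec_matpow_0: "i < n \<Longrightarrow> mvec n (matpow n a 0) x i = x i"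
proof -
  assume "i < n"
  moreover have "mvec n (matpow n a 0) x i = (\<Sum>j<n. if j = i then x j else 0)"
    unfolding mvec_def by (intro sum.cong) auto
  ultimately show ?thesis by simp
qed

lemma mvec_matpow_Suc: "mvec n (matpow n a (Suc k)) x = mvec n a (mvec n (matpow n a k) x)"
proof
  fix i
  have "mvec n (matpow n a (Suc k)) x i = (\<Sum>j<n. \<Sum>y<n. a i y * (matpow n a k y j * x j))"
    by (simp add: mvec_def sum_distrib_right mult.assoc)
  also have "\<dots> = (\<Sum>y<n. \<Sum>j<n. a i y * (matpow n a k y j * x j))" by (rule sum.swap)
  also have "\<dots> = mvec n a (mvec n (matpow n a k) x) i" by (simp add: mvec_def sum_distrib_left)
  finally show "mvec n (matpow n a (Suc k)) x i = mvec n a (mvec n (matpow n a k) x) i" .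
qed

lemma mvec_norm_le_Frobenius:
  "dotp n (mvec n b x) (mvec n b x) \<le> (\<Sum>i<n. \<Sum>j<n. (b i j)\<^sup>2) * dotp n x x"
proof -
  have "dotp n (mvec n b x) (mvec n b x) = (\<Sum>i<n. (\<Sum>j<n. b i j * x j)\<^sup>2)"
    by (simp add: dotp_def mvec_def power2_eq_square)
  also have "\<dots> \<le> (\<Sum>i<n. (\<Sum>j<n. (b i j)\<^sup>2) * (\<Sum>j<n. (x j)\<^sup>2))"
    by (intro sum_mono Cauchy_Schwarz_ineq_sum)
  finally show ?thesis by (simp add: dotp_def sum_distrib_right power2_eq_square)
qed

text \<open>The squared norms \<open>N k\<close> of the iterates are log-convex: by symmetry
  \<open>N (Suc k)\<close> is the inner product of iterates k and k + 2, and Cauchy-Schwarz applies.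
  Successive ratios therefore never fall below the first, which is \<open>N 1\<close> since
  \<open>N 0\<close> is 1.\<close>

lemma norm_power_le_matpow_norm:
  assumes sym: "symm n a" and x: "dotp n x x = 1"
  shows "dotp n (mvec n a x) (mvec n a x) ^ k \<le> dotp n (mvec n (matpow n a k) x) (mvec n (matpow n a k) x)"
proof -
  define z where "z = (\<lambda>k. mvec n (matpow n a k) x)"
  define N where "N = (\<lambda>k. dotp n (z k) (z k))"
  have zS: "z (Suc k) = mvec n a (z k)" for k by (simp add: z_def mvec_matpow_Suc del: matpow.simps)
  have z1: "z 1 = mvec n a x"
    unfolding One_nat_def zS by (intro mvec_cong) (simp add: z_def mvec_matpow_0 del: matpow.simps)
  have N0: "N 0 = 1" unfolding N_def x[symmetric]
    by (intro dotp_cong) (simp_all add: z_def mvec_matpow_0 del: matpow.simps)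
  have nn: "0 \<le> N k" for k by (simp add: N_def dotp_self_nonneg)
  have conv: "(N (Suc k))\<^sup>2 \<le> N k * N (Suc (Suc k))" for k
  proof -
    have "N (Suc k) = dotp n (z k) (z (Suc (Suc k)))"
      unfolding N_def zS[of "Suc k"] dotp_mvec_symm[OF sym, of "z k"] by (simp only: zS)
    thus ?thesis using dotp_Cauchy_Schwarz[of n "z k" "z (Suc (Suc k))"] by (simp add: N_def)
  qed
  have step: "N 1 * N k \<le> N (Suc k)" for k
  proof (induction k)
    case (Suc k)
    show ?case
    proof (cases "N k = 0")
      case True
      hence "\<forall>i<n. z k i = 0" by (simp add: N_def dotp_self_eq_0)
      hence "z (Suc k) = mvec n a (\<lambda>_. 0)" unfolding zS by (intro mvec_cong) auto
      hence "N (Suc k) = 0" by (simp add: N_def mvec_def dotp_def)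
      thus ?thesis using nn by simp
    next
      case False
      hence pos: "N k > 0" using nn[of k] by simp
      have "N k * (N 1 * N (Suc k)) \<le> N (Suc k) * N (Suc k)"
        using mult_right_mono[OF Suc.IH nn[of "Suc k"]] by (simp add: mult_ac)
      also have "\<dots> \<le> N k * N (Suc (Suc k))" using conv[of k] by (simp add: power2_eq_square)
      finally show ?thesis using pos by simp
    qed
  qed (simp add: N0)
  have "N 1 ^ k \<le> N k"
  proof (induction k)
    case (Suc k)
    have "N 1 ^ Suc k \<le> N 1 * N k" using Suc nn by (simp add: mult_left_mono)
    thus ?case using step[of k] by simp
  qed (simp add: N0)
  thus ?thesis unfolding N_def z1 by (simp only: z_def)
qed

text \<open>For unit x, |a x|^(2 k) \<le> |a^k x|^2, which is at most the squared Frobenius norm of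
  a^k, that is the trace of a^(2 k). Other vectors follow by scaling.\<close>

lemma quadratic_form_le_of_trace:
  assumes sym: "symm n a" and T: "0 < T" and k: "k > 0"
    and tr: "(\<Sum>i<n. matpow n a (2 * k) i i) \<le> T ^ (2 * k)"
  shows "\<bar>dotp n x (mvec n a x)\<bar> \<le> T * dotp n x x"
proof -
  have unit: "\<bar>dotp n x (mvec n a x)\<bar> \<le> T" if x: "dotp n x x = 1" for x
  proof -
    let ?N = "dotp n (mvec n a x) (mvec n a x)"
    have "?N ^ k \<le> dotp n (mvec n (matpow n a k) x) (mvec n (matpow n a k) x)"
      by (rule norm_power_le_matpow_norm[OF sym x])
    also have "\<dots> \<le> (\<Sum>i<n. \<Sum>j<n. (matpow n a k i j)\<^sup>2) * dotp n x x" by (rule mvec_norm_le_Frobenius)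
    also have "\<dots> \<le> (T\<^sup>2) ^ k" using tr unfolding trace_matpow_double[OF sym] x by (simp add: power_mult)
    finally have "?N \<le> T\<^sup>2" using k by (simp add: power_mono_iff dotp_self_nonneg)
    hence "(dotp n x (mvec n a x))\<^sup>2 \<le> T\<^sup>2" using dotp_Cauchy_Schwarz[of n x "mvec n a x"] x by simp
    thus ?thesis using T by (simp add: abs_le_square_iff[symmetric])
  qed
  show ?thesis
  proof (cases "dotp n x x = 0")
    case True
    hence "dotp n x (mvec n a x) = 0" unfolding dotp_self_eq_0 by (simp add: dotp_def)
    thus ?thesis using True by simp
  next
    case False
    hence pos: "0 < dotp n x x" using dotp_self_nonneg[of n x] by simp
    let ?c = "inverse (sqrt (dotp n x x))"
    have c2: "?c\<^sup>2 = inverse (dotp n x x)" using pos by (simp add: power_inverse)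
    have "dotp n (\<lambda>i. ?c * x i) (\<lambda>i. ?c * x i) = ?c\<^sup>2 * dotp n x x"
      by (simp add: dotp_scale_left dotp_scale_right power2_eq_square)
    hence "\<bar>?c\<^sup>2 * dotp n x (mvec n a x)\<bar> \<le> T"
      using unit[of "\<lambda>i. ?c * x i"] pos unfolding quadratic_form_scale c2 by simp
    thus ?thesis unfolding c2 using pos by (simp add: abs_mult field_simps)
  qed
qed

lemma symm_noise: "symm n (noise pr E)"
  by (simp add: symm_def noise_def edge_commute)

text \<open>Markov's inequality for the trace at the threshold (12 s)^(2 k): the ratio of 12 s to
  the rate 4 s is the base 3 of the failure bound.\<close>

lemma noise_quadratic_form_whp:
  assumes pr: "\<And>e. 0 \<le> pr e \<and> pr e \<le> 1 \<and> pr e * (1 - pr e) \<le> v"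
    and v: "v \<le> 1" and s: "0 < s" "s\<^sup>2 = real n * v" "(real (2 * k + 1))\<^sup>2 \<le> s" and k: "k > 0"
  shows "measure_pmf.prob (random_graph n pr)
      {E. \<forall>x. \<bar>dotp n x (mvec n (noise pr E) x)\<bar> \<le> 12 * s * dotp n x x}
    \<ge> 1 - real n / 3 ^ (2 * k)"
proof -
  let ?D = "measure_pmf (random_graph n pr)"
  let ?G = "{E. \<forall>x. \<bar>dotp n x (mvec n (noise pr E) x)\<bar> \<le> 12 * s * dotp n x x}"
  let ?F = "\<lambda>E. \<Sum>i<n. matpow n (noise pr E) (2 * k) i i"
  have "measure ?D {E \<in> space ?D. ?F E \<ge> (12 * s) ^ (2 * k)} \<le> measure_pmf.expectation (random_graph n pr) ?F / (12 * s) ^ (2 * k)"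
  proof (rule integral_Markov_inequality_measure)
    show "integrable ?D ?F" by (rule integrable_random_graph)
    show "AE x in ?D. 0 \<le> ?F x"
      unfolding trace_matpow_double[OF symm_noise] by (simp add: sum_nonneg)
  qed (use s in auto)
  also have "\<dots> \<le> real n * (4 * s) ^ (2 * k) / (12 * s) ^ (2 * k)"
    using s by (intro divide_right_mono expectation_trace_power[OF pr v]) (auto simp: add_ac)
  also have "\<dots> = real n / 3 ^ (2 * k)"
  proof -
    have "(12 * s) ^ (2 * k) = 3 ^ (2 * k) * (4 * s) ^ (2 * k)" by (subst power_mult_distrib[symmetric]) simp
    moreover have "(4 * s) ^ (2 * k) \<noteq> 0" using s by simp
    ultimately show ?thesis by (metis mult.commute mult_divide_mult_cancel_right)
  qed
  finally have "measure ?D {E. ?F E \<ge> (12 * s) ^ (2 * k)} \<le> real n / 3 ^ (2 * k)" by simp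
  moreover have "measure ?D (- ?G) \<le> measure ?D {E. ?F E \<ge> (12 * s) ^ (2 * k)}"
  proof (rule measure_pmf.finite_measure_mono)
    show "- ?G \<subseteq> {E. ?F E \<ge> (12 * s) ^ (2 * k)}"
    proof
      fix E assume "E \<in> - ?G"
      hence "\<not> (?F E \<le> (12 * s) ^ (2 * k))"
        using quadratic_form_le_of_trace[OF symm_noise, of "12 * s" k n pr E] s k by auto
      thus "E \<in> {E. ?F E \<ge> (12 * s) ^ (2 * k)}" by simp
    qed
  qed simp
  moreover have "measure ?D (- ?G) = 1 - measure ?D ?G"
    using measure_pmf.prob_compl[of ?G "random_graph n pr"] by (simp add: Compl_eq_Diff_UNIV)
  ultimately show ?thesis by simp
qed

section \<open>Spectrum of the adjacency matrix\<close>

definition edge_prob :: "(nat \<Rightarrow> nat) \<Rightarrow> real \<Rightarrow> real \<Rightarrow> nat \<times> nat \<Rightarrow> real" where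
  "edge_prob cl p q = (\<lambda>(i, j). if cl i = cl j then p else q)"

definition adj :: "(nat \<times> nat \<Rightarrow> bool) \<Rightarrow> nat \<Rightarrow> nat \<Rightarrow> real" where
  "adj E i j = (if i = j then 1 else of_bool (E (edge i j)))"

text \<open>The block and constant parts put p on the diagonal while \<open>adj\<close> has 1 there;
  the multiple 1 - p of the identity makes up the difference.\<close>

definition mean_adj :: "(nat \<Rightarrow> nat) \<Rightarrow> real \<Rightarrow> real \<Rightarrow> nat \<Rightarrow> nat \<Rightarrow> real" where
  "mean_adj cl p q i j = (1 - p) * of_bool (i = j) + (p - q) * of_bool (cl i = cl j) + q"

definition cluster_ind :: "(nat \<Rightarrow> nat) \<Rightarrow> nat \<Rightarrow> nat \<Rightarrow> real" where
  "cluster_ind cl k i = of_bool (cl i = k)"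

lemma sbm_eq_random_graph: "sbm n cl p q = random_graph n (edge_prob cl p q)"
  unfolding sbm_def random_graph_def edge_prob_def
  by (rule arg_cong[where f = "Pi_pmf (node_pairs n) False"]) auto

lemma adj_matrix_eq: "adj_matrix n E = Matrix.mat n n (\<lambda>(i, j). adj E i j)"
  unfolding adj_matrix_def by (rule arg_cong[where f = "Matrix.mat n n"]) (auto simp: adj_def edge_def)

lemma symm_adj: "symm n (adj E)"
  by (auto simp: symm_def adj_def edge_commute)

lemma adj_decomp: "adj E i j = mean_adj cl p q i j + noise (edge_prob cl p q) E i j"
  by (auto simp: adj_def mean_adj_def noise_def edge_prob_def edge_def min_def max_def)

text \<open>The mean is never diagonalised: the min-max bounds use only this expression through
  pairings with the cluster indicators and the all-ones vector.\<close>

lemma quadratic_form_mean_adj: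
  assumes "\<And>i. i < n \<Longrightarrow> cl i < r"
  shows "dotp n x (mvec n (mean_adj cl p q) x) = (1 - p) * dotp n x x +
    (p - q) * (\<Sum>k<r. (dotp n (cluster_ind cl k) x)\<^sup>2) + q * (dotp n (\<lambda>_. 1) x)\<^sup>2"
proof -
  have "dotp n x (mvec n (mean_adj cl p q) x) =
    (\<Sum>i<n. \<Sum>j<n. (1 - p) * (of_bool (i = j) * x i * x j) + (p - q) * (of_bool (cl i = cl j) * x i * x j) + q * (x i * x j))"
    by (simp add: dotp_def mvec_def mean_adj_def sum_distrib_left algebra_simps)
  also have "\<dots> = (1 - p) * (\<Sum>i<n. \<Sum>j<n. of_bool (i = j) * x i * x j) +
    (p - q) * (\<Sum>i<n. \<Sum>j<n. of_bool (cl i = cl j) * x i * x j) + q * (\<Sum>i<n. \<Sum>j<n. x i * x j)"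
    by (simp add: sum.distrib sum_distrib_left)
  also have "(\<Sum>i<n. \<Sum>j<n. of_bool (i = j) * x i * x j) = dotp n x x"
    unfolding dotp_def
  proof (intro sum.cong refl)
    fix i assume "i \<in> {..<n}"
    have "(\<Sum>j<n. of_bool (i = j) * x i * x j) = (\<Sum>j<n. if j = i then x i * x j else 0)"
      by (intro sum.cong) auto
    thus "(\<Sum>j<n. of_bool (i = j) * x i * x j) = x i * x i" using \<open>i \<in> {..<n}\<close> by simp
  qed
  also have "(\<Sum>i<n. \<Sum>j<n. of_bool (cl i = cl j) * x i * x j) = (\<Sum>k<r. (dotp n (cluster_ind cl k) x)\<^sup>2)"
  proof -
    have "(\<Sum>k<r. (dotp n (cluster_ind cl k) x)\<^sup>2) =
      (\<Sum>k<r. \<Sum>i<n. \<Sum>j<n. (cluster_ind cl k i * x i) * (cluster_ind cl k j * x j))"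
      by (simp add: dotp_def power2_eq_square sum_product)
    also have "\<dots> = (\<Sum>i<n. \<Sum>j<n. \<Sum>k<r. (cluster_ind cl k i * x i) * (cluster_ind cl k j * x j))"
      by (subst sum.swap) (rule sum.cong[OF refl], rule sum.swap)
    also have "\<dots> = (\<Sum>i<n. \<Sum>j<n. of_bool (cl i = cl j) * x i * x j)"
    proof (intro sum.cong refl)
      fix i j assume "i \<in> {..<n}" "j \<in> {..<n}"
      hence "cl i < r" using assms by auto
      have "(\<Sum>k<r. (cluster_ind cl k i * x i) * (cluster_ind cl k j * x j)) =
        (\<Sum>k<r. if k = cl i then of_bool (cl i = cl j) * x i * x j else 0)"
        by (intro sum.cong) (auto simp: cluster_ind_def)
      thus "(\<Sum>k<r. (cluster_ind cl k i * x i) * (cluster_ind cl k j * x j)) = of_bool (cl i = cl j) * x i * x j"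
        using \<open>cl i < r\<close> by simp
    qed
    finally show ?thesis ..
  qed
  also have "(\<Sum>i<n. \<Sum>j<n. x i * x j) = (dotp n (\<lambda>_. 1) x)\<^sup>2"
    by (simp add: dotp_def power2_eq_square sum_product)
  finally show ?thesis .
qed

section \<open>Eigenvalues and estimators for a graph with small noise\<close>

text \<open>One outcome \<open>E\<close> is fixed and randomness is replaced by the assumed noise
  bound, so everything inside is deterministic.\<close>

locale balanced_sbm =
  fixes n r K :: nat and cl :: "nat \<Rightarrow> nat" and p q \<delta> :: real and E :: "nat \<times> nat \<Rightarrow> bool"
  assumes n_eq: "n = r * K" and balanced: "balanced_clusters n r K cl"
    and K_ge_2: "K \<ge> 2" and r_ge_2: "r \<ge> 2" and q_nonneg: "0 \<le> q" and q_less_p: "q < p"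
    and noise_le: "\<bar>dotp n x (mvec n (noise (edge_prob cl p q) E) x)\<bar> \<le> \<delta> * dotp n x x"
begin

abbreviation "ind \<equiv> cluster_ind cl"
abbreviation "\<Lambda> \<equiv> lam (adj_matrix n E)"

lemma cl_less: "i < n \<Longrightarrow> cl i < r"
  using balanced by (simp add: balanced_clusters_def)

lemma n_pos: "n > 0"
  using n_eq K_ge_2 r_ge_2 by simp

lemma r_less_n: "r < n"
proof -
  have "r * 1 < r * K" using K_ge_2 r_ge_2 by (intro mult_strict_left_mono) auto
  thus ?thesis by (simp add: n_eq)
qed

lemma sum_cluster_ind:
  assumes "k < r" shows "(\<Sum>i<n. ind k i) = real K"
proof -
  have "(\<Sum>i<n. ind k i) = real (card ({..<n} \<inter> {i. cl i = k}))"
    by (simp add: cluster_ind_def of_bool_def sum.If_cases)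
  also have "{..<n} \<inter> {i. cl i = k} = {i. i < n \<and> cl i = k}" by auto
  finally show ?thesis using balanced assms by (simp add: balanced_clusters_def)
qed

lemma dotp_ind_ind:
  assumes "k < r" shows "dotp n (ind k) (ind l) = real K * of_bool (k = l)"
proof -
  have "dotp n (ind k) (ind l) = (\<Sum>i<n. ind k i * of_bool (k = l))"
    unfolding dotp_def by (intro sum.cong) (auto simp: cluster_ind_def)
  also have "\<dots> = (\<Sum>i<n. ind k i) * of_bool (k = l)" by (rule sum_distrib_right[symmetric])
  finally show ?thesis by (simp add: sum_cluster_ind[OF assms])
qed

lemma sum_clusters: "i < n \<Longrightarrow> (\<Sum>k<r. ind k i) = 1"
  using cl_less[of i] by (simp add: cluster_ind_def of_bool_def eq_commute[of "cl i"])

lemma dotp_one: "dotp n (\<lambda>_. 1) x = (\<Sum>k<r. dotp n (ind k) x)"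
proof -
  have "dotp n (\<lambda>_. 1) x = dotp n (\<lambda>i. \<Sum>k<r. 1 * ind k i) x"
    by (intro dotp_cong) (simp_all add: sum_clusters)
  also have "\<dots> = (\<Sum>k<r. 1 * dotp n (ind k) x)" by (rule dotp_sum_left)
  finally show ?thesis by simp
qed

lemma quadratic_form_adj:
  "\<bar>dotp n x (mvec n (adj E) x) - ((1 - p) * dotp n x x +
    (p - q) * (\<Sum>k<r. (dotp n (ind k) x)\<^sup>2) + q * (dotp n (\<lambda>_. 1) x)\<^sup>2)\<bar> \<le> \<delta> * dotp n x x"
proof -
  have "adj E = (\<lambda>i j. mean_adj cl p q i j + noise (edge_prob cl p q) E i j)"
    by (intro ext adj_decomp)
  hence "dotp n x (mvec n (adj E) x) = dotp n x (mvec n (mean_adj cl p q) x) + dotp n x (mvec n (noise (edge_prob cl p q) E) x)"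
    by (simp add: mvec_matrix_add dotp_add_right)
  thus ?thesis using noise_le[of x] quadratic_form_mean_adj[of n cl r x p q] cl_less by simp
qed

text \<open>Pairing with a cluster indicator sees only the part of \<open>x\<close> on that cluster.
  Cauchy-Schwarz there gives the factor K, and the parts add up because the clusters partition the
  nodes.\<close>

lemma sum_cluster_squares_le: "(\<Sum>k<r. (dotp n (ind k) x)\<^sup>2) \<le> real K * dotp n x x"
proof -
  have "(\<Sum>k<r. (dotp n (ind k) x)\<^sup>2) \<le> (\<Sum>k<r. real K * (\<Sum>i<n. ind k i * (x i)\<^sup>2))"
  proof (intro sum_mono)
    fix k assume k: "k \<in> {..<r}"
    have "dotp n (ind k) x = dotp n (ind k) (\<lambda>i. ind k i * x i)"
      unfolding dotp_def by (intro sum.cong) (auto simp: cluster_ind_def)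
    hence "(dotp n (ind k) x)\<^sup>2 \<le> dotp n (ind k) (ind k) * dotp n (\<lambda>i. ind k i * x i) (\<lambda>i. ind k i * x i)"
      using dotp_Cauchy_Schwarz[of n "ind k" "\<lambda>i. ind k i * x i"] by simp
    also have "dotp n (\<lambda>i. ind k i * x i) (\<lambda>i. ind k i * x i) = (\<Sum>i<n. ind k i * (x i)\<^sup>2)"
      unfolding dotp_def by (intro sum.cong) (auto simp: cluster_ind_def power2_eq_square)
    finally show "(dotp n (ind k) x)\<^sup>2 \<le> real K * (\<Sum>i<n. ind k i * (x i)\<^sup>2)"
      using dotp_ind_ind[of k k] k by simp
  qed
  also have "\<dots> = real K * (\<Sum>i<n. (\<Sum>k<r. ind k i) * (x i)\<^sup>2)"
    unfolding sum_distrib_left[symmetric] sum_distrib_right by (subst sum.swap) (rule refl)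
  also have "\<dots> = real K * dotp n x x"
    unfolding dotp_def by (simp add: sum_clusters power2_eq_square)
  finally show ?thesis .
qed

lemma upper_first: "\<Lambda> 1 \<le> (1 - p) + (p - q) * K + q * n + \<delta>"
proof -
  have "lam (Matrix.mat n n (\<lambda>(i, j). adj E i j)) (Suc 0) \<le> (1 - p) + (p - q) * K + q * n + \<delta>"
  proof (rule lam_le_of_constraints[OF symm_adj n_pos])
    fix x
    have "(p - q) * (\<Sum>k<r. (dotp n (ind k) x)\<^sup>2) \<le> (p - q) * (real K * dotp n x x)"
      using q_less_p sum_cluster_squares_le by (intro mult_left_mono) auto
    moreover have "q * (dotp n (\<lambda>_. 1) x)\<^sup>2 \<le> q * (real n * dotp n x x)"
      using q_nonneg dotp_Cauchy_Schwarz[of n "\<lambda>_. 1" x] by (intro mult_left_mono) (auto simp: dotp_def[of n "\<lambda>_. 1" "\<lambda>_. 1"])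
    ultimately have "dotp n x (mvec n (adj E) x) \<le> (1 - p) * dotp n x x + (p - q) * (real K * dotp n x x) +
        q * (real n * dotp n x x) + \<delta> * dotp n x x"
      using quadratic_form_adj[of x] by linarith
    thus "dotp n x (mvec n (adj E) x) \<le> ((1 - p) + (p - q) * K + q * n + \<delta>) * dotp n x x"
      by (simp add: algebra_simps)
  qed
  thus ?thesis by (simp add: adj_matrix_eq)
qed

lemma lower_first: "\<Lambda> 1 \<ge> (1 - p) + (p - q) * K + q * n - \<delta>"
proof -
  have "(1 - p) + (p - q) * K + q * n - \<delta> \<le> lam (Matrix.mat n n (\<lambda>(i, j). adj E i j)) (Suc 0)"
  \<comment> \<open>The constant vector is an eigenvector of the mean for its largest eigenvalue, so
    a one-dimensional test space suffices.\<close>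
  proof (rule lam_ge_of_subspace[OF symm_adj n_pos, where v = "\<lambda>_ _. 1"])
    fix c :: "nat \<Rightarrow> real" assume "\<exists>k\<le>0. c k \<noteq> 0"
    hence c: "c 0 \<noteq> 0" by simp
    define x where "x = (\<lambda>j::nat. \<Sum>k\<le>(0::nat). c k * 1)"
    have x: "x = (\<lambda>_. c 0)" by (simp add: x_def)
    have xx: "dotp n x x = real n * (c 0)\<^sup>2" by (simp add: x dotp_def power2_eq_square)
    have "dotp n (ind k) x = c 0 * real K" if "k < r" for k
      using sum_cluster_ind[OF that] by (simp add: x dotp_def sum_distrib_right[symmetric])
    hence "(\<Sum>k<r. (dotp n (ind k) x)\<^sup>2) = real r * (c 0 * real K)\<^sup>2" by simp
    also have "\<dots> = real K * dotp n x x" unfolding xx by (simp add: n_eq power2_eq_square)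
    finally have S: "(\<Sum>k<r. (dotp n (ind k) x)\<^sup>2) = real K * dotp n x x" .
    have O: "(dotp n (\<lambda>_. 1) x)\<^sup>2 = real n * dotp n x x" unfolding xx by (simp add: x dotp_def power2_eq_square)
    have "(1 - p) * dotp n x x + (p - q) * (real K * dotp n x x) + q * (real n * dotp n x x) - \<delta> * dotp n x x
      \<le> dotp n x (mvec n (adj E) x)"
      using quadratic_form_adj[of x] unfolding S O by linarith
    hence "((1 - p) + (p - q) * K + q * n - \<delta>) * dotp n x x \<le> dotp n x (mvec n (adj E) x)"
      by (simp add: algebra_simps)
    moreover have "0 < dotp n x x" using xx c n_pos by simp
    ultimately show "let x = (\<lambda>j::nat. \<Sum>k\<le>(0::nat). c k * 1) in 0 < dotp n x x \<and>
        ((1 - p) + (p - q) * K + q * n - \<delta>) * dotp n x x \<le> dotp n x (mvec n (adj E) x)"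
      unfolding x_def[symmetric] Let_def by blast
  qed
  thus ?thesis by (simp add: adj_matrix_eq)
qed

lemma upper_middle:
  assumes "2 \<le> i" "i \<le> n" shows "\<Lambda> i \<le> (1 - p) + (p - q) * K + \<delta>"
proof -
  have "lam (Matrix.mat n n (\<lambda>(i, j). adj E i j)) (Suc (i - 1)) \<le> (1 - p) + (p - q) * K + \<delta>"
  \<comment> \<open>All i - 1 \<ge> 1 constraints are the same: orthogonality to the all-ones
    vector, which kills the q term.\<close>
  proof (rule lam_le_of_constraints[OF symm_adj, where w = "\<lambda>_ _. 1"])
    show "i - 1 < n" using assms by simp
    fix x assume "\<forall>j<i - 1. dotp n (\<lambda>_. 1) x = 0"
    moreover have "0 < i - 1" using assms by simp
    ultimately have O: "dotp n (\<lambda>_. 1) x = 0" by blast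
    have "(p - q) * (\<Sum>k<r. (dotp n (ind k) x)\<^sup>2) \<le> (p - q) * (real K * dotp n x x)"
      using q_less_p sum_cluster_squares_le by (intro mult_left_mono) auto
    hence "dotp n x (mvec n (adj E) x) \<le> (1 - p) * dotp n x x + (p - q) * (real K * dotp n x x) + \<delta> * dotp n x x"
      using quadratic_form_adj[of x] unfolding O by simp
    thus "dotp n x (mvec n (adj E) x) \<le> ((1 - p) + (p - q) * K + \<delta>) * dotp n x x"
      by (simp add: algebra_simps)
  qed
  thus ?thesis using assms by (simp add: adj_matrix_eq)
qed

lemma lower_middle:
  assumes "1 \<le> i" "i \<le> r" shows "\<Lambda> i \<ge> (1 - p) + (p - q) * K - \<delta>"
proof -
  have "(1 - p) + (p - q) * K - \<delta> \<le> lam (Matrix.mat n n (\<lambda>(i, j). adj E i j)) (Suc (i - 1))"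
  \<comment> \<open>On the span of cluster indicators the block part acts as K times the identity,
    and the q term is nonnegative.\<close>
  proof (rule lam_ge_of_subspace[OF symm_adj, where v = ind])
    show "i - 1 < n" using assms r_less_n by simp
    fix c :: "nat \<Rightarrow> real" assume c: "\<exists>k\<le>i - 1. c k \<noteq> 0"
    define x where "x = (\<lambda>j. \<Sum>k\<le>i - 1. c k * ind k j)"
    have d: "dotp n (ind l) x = (if l \<le> i - 1 then real K * c l else 0)" if "l < r" for l
    proof -
      have "dotp n (ind l) x = (\<Sum>k\<le>i - 1. c k * dotp n (ind l) (ind k))"
        unfolding x_def by (rule dotp_sum_right)
      also have "\<dots> = (\<Sum>k\<le>i - 1. if k = l then real K * c l else 0)"
        using dotp_ind_ind[OF that] by (intro sum.cong) auto
      finally show ?thesis by simp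
    qed
    have ir: "k < r" if "k \<le> i - 1" for k using that assms by linarith
    have xx: "dotp n x x = real K * (\<Sum>k\<le>i - 1. (c k)\<^sup>2)"
    proof -
      have "dotp n x x = (\<Sum>k\<le>i - 1. c k * dotp n (ind k) x)"
        by (subst x_def) (rule dotp_sum_left)
      also have "\<dots> = (\<Sum>k\<le>i - 1. real K * (c k)\<^sup>2)"
        using d ir by (intro sum.cong) (auto simp: power2_eq_square)
      finally show ?thesis by (simp add: sum_distrib_left)
    qed
    have "real K * dotp n x x = (\<Sum>k\<le>i - 1. (dotp n (ind k) x)\<^sup>2)"
      unfolding xx sum_distrib_left using d ir by (intro sum.cong) (auto simp: power2_eq_square)
    also have "\<dots> \<le> (\<Sum>k<r. (dotp n (ind k) x)\<^sup>2)"
      using ir by (intro sum_mono2) auto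
    finally have "(p - q) * (real K * dotp n x x) \<le> (p - q) * (\<Sum>k<r. (dotp n (ind k) x)\<^sup>2)"
      using q_less_p by (intro mult_left_mono) auto
    moreover have "0 \<le> q * (dotp n (\<lambda>_. 1) x)\<^sup>2" using q_nonneg by simp
    ultimately have "(1 - p) * dotp n x x + (p - q) * (real K * dotp n x x) - \<delta> * dotp n x x
      \<le> dotp n x (mvec n (adj E) x)"
      using quadratic_form_adj[of x] by linarith
    hence "((1 - p) + (p - q) * K - \<delta>) * dotp n x x \<le> dotp n x (mvec n (adj E) x)"
      by (simp add: algebra_simps)
    moreover have "0 < dotp n x x"
    proof -
      obtain k where "k \<le> i - 1" "c k \<noteq> 0" using c by blast
      hence "0 < (\<Sum>k\<le>i - 1. (c k)\<^sup>2)" by (intro sum_pos2[of _ k]) auto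
      thus ?thesis using xx K_ge_2 by simp
    qed
    ultimately show "let x = (\<lambda>j. \<Sum>k\<le>i - 1. c k * ind k j) in 0 < dotp n x x \<and>
        ((1 - p) + (p - q) * K - \<delta>) * dotp n x x \<le> dotp n x (mvec n (adj E) x)"
      unfolding x_def[symmetric] Let_def by blast
  qed
  thus ?thesis using assms by (simp add: adj_matrix_eq)
qed

lemma upper_last:
  assumes "r < i" "i \<le> n" shows "\<Lambda> i \<le> (1 - p) + \<delta>"
proof -
  have "lam (Matrix.mat n n (\<lambda>(i, j). adj E i j)) (Suc (i - 1)) \<le> (1 - p) + \<delta>"
  \<comment> \<open>The constraints include all r cluster indicators, hence also their sum, the
    all-ones vector; the block and q terms both vanish.\<close>
  proof (rule lam_le_of_constraints[OF symm_adj, where w = ind])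
    show "i - 1 < n" using assms by simp
    fix x assume "\<forall>j<i - 1. dotp n (ind j) x = 0"
    hence z: "dotp n (ind j) x = 0" if "j < r" for j using that assms by auto
    show "dotp n x (mvec n (adj E) x) \<le> ((1 - p) + \<delta>) * dotp n x x"
      using quadratic_form_adj[of x] z dotp_one[of x] by (simp add: algebra_simps)
  qed
  thus ?thesis using assms by (simp add: adj_matrix_eq)
qed

lemma lower_last:
  assumes "1 \<le> i" "i \<le> n" shows "\<Lambda> i \<ge> (1 - p) - \<delta>"
proof -
  have "(1 - p) - \<delta> \<le> lam (Matrix.mat n n (\<lambda>(i, j). adj E i j)) (Suc (i - 1))"
  \<comment> \<open>The block and q parts are positive semidefinite, so any test space of dimension
    i will do; coordinate vectors are the simplest.\<close>
  proof (rule lam_ge_of_subspace[OF symm_adj, where v = "\<lambda>k j. of_bool (j = k)"])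
    show "i - 1 < n" using assms by simp
    fix c :: "nat \<Rightarrow> real" assume "\<exists>k\<le>i - 1. c k \<noteq> 0"
    then obtain k where k: "k \<le> i - 1" "c k \<noteq> 0" by blast
    define x where "x = (\<lambda>j::nat. \<Sum>k\<le>i - 1. c k * of_bool (j = k))"
    have "x k = (\<Sum>l\<le>i - 1. if l = k then c l else 0)" unfolding x_def by (intro sum.cong) auto
    hence "x k \<noteq> 0" using k by simp
    moreover have "k < n" using k assms by linarith
    ultimately have pos: "0 < dotp n x x" using dotp_self_pos_iff by blast
    have "0 \<le> (p - q) * (\<Sum>k<r. (dotp n (ind k) x)\<^sup>2)" using q_less_p by (simp add: sum_nonneg)
    moreover have "0 \<le> q * (dotp n (\<lambda>_. 1) x)\<^sup>2" using q_nonneg by simp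
    ultimately have "(1 - p) * dotp n x x - \<delta> * dotp n x x \<le> dotp n x (mvec n (adj E) x)"
      using quadratic_form_adj[of x] by linarith
    hence "((1 - p) - \<delta>) * dotp n x x \<le> dotp n x (mvec n (adj E) x)" by (simp add: algebra_simps)
    with pos show "let x = (\<lambda>j::nat. \<Sum>k\<le>i - 1. c k * of_bool (j = k)) in 0 < dotp n x x \<and>
        ((1 - p) - \<delta>) * dotp n x x \<le> dotp n x (mvec n (adj E) x)"
      unfolding x_def[symmetric] Let_def by blast
  qed
  thus ?thesis using assms by (simp add: adj_matrix_eq)
qed

text \<open>Away from r, both eigenvalues of a candidate gap come from equal mean eigenvalues, so
  the gap is at most 2 \<delta>, while the gap at r is at least (p - q) K - 2 \<delta>. The gap
  after the first eigenvalue does not compete, since the search starts at 2.\<close>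

lemma gap_argmax_eq:
  assumes "4 * \<delta> < (p - q) * K" and "rh \<in> gap_argmax n (adj_matrix n E)"
  shows "rh = r"
proof (rule ccontr)
  assume neq: "rh \<noteq> r"
  have rh: "2 \<le> rh" "rh \<le> n - 1"
    and max: "\<And>j. 2 \<le> j \<Longrightarrow> j \<le> n - 1 \<Longrightarrow> \<Lambda> j - \<Lambda> (j + 1) \<le> \<Lambda> rh - \<Lambda> (rh + 1)"
    using assms(2) by (auto simp: gap_argmax_def)
  have "\<Lambda> r - \<Lambda> (r + 1) \<le> \<Lambda> rh - \<Lambda> (rh + 1)" using r_ge_2 r_less_n by (intro max) auto
  moreover have "\<Lambda> r \<ge> (1 - p) + (p - q) * K - \<delta>" using r_ge_2 by (intro lower_middle) auto
  moreover have "\<Lambda> (r + 1) \<le> (1 - p) + \<delta>" using r_less_n by (intro upper_last) auto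
  moreover have "\<Lambda> rh - \<Lambda> (rh + 1) \<le> 2 * \<delta>"
  proof (cases "rh < r")
    case True
    have "\<Lambda> rh \<le> (1 - p) + (p - q) * K + \<delta>" using rh by (intro upper_middle) auto
    moreover have "\<Lambda> (rh + 1) \<ge> (1 - p) + (p - q) * K - \<delta>" using True by (intro lower_middle) auto
    ultimately show ?thesis by linarith
  next
    case False
    have "\<Lambda> rh \<le> (1 - p) + \<delta>" using rh False neq by (intro upper_last) auto
    moreover have "\<Lambda> (rh + 1) \<ge> (1 - p) - \<delta>" using rh n_pos by (intro lower_last) auto
    ultimately show ?thesis by linarith
  qed
  ultimately show False using assms(1) by linarith
qed

lemma q_hat_error: "\<bar>q_hat n (adj_matrix n E) - q\<bar> \<le> 2 * \<delta> / n"
proof -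
  have "\<Lambda> 2 \<le> (1 - p) + (p - q) * K + \<delta>" "\<Lambda> 2 \<ge> (1 - p) + (p - q) * K - \<delta>"
    using r_ge_2 r_less_n by (auto intro!: upper_middle lower_middle)
  hence "\<bar>\<Lambda> 1 - \<Lambda> 2 - q * n\<bar> \<le> 2 * \<delta>" using upper_first lower_first by linarith
  moreover have "q_hat n (adj_matrix n E) - q = (\<Lambda> 1 - \<Lambda> 2 - q * n) / n"
    using n_pos by (simp add: q_hat_def field_simps)
  ultimately show ?thesis using n_pos by (simp add: divide_right_mono)
qed

text \<open>With the mean eigenvalues the numerator of \<open>p_hat\<close> is exactly n p (K - 1),
  the q terms cancelling. The weights K and n - K add up to n, so the perturbation is at most n
  \<delta>.\<close>

lemma p_hat_error: "\<bar>p_hat n (real K) (adj_matrix n E) - p\<bar> \<le> \<delta> / (real K - 1)"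
proof -
  have "\<bar>\<Lambda> 1 - ((1 - p) + (p - q) * K + q * n)\<bar> \<le> \<delta>" using upper_first lower_first by linarith
  hence 1: "\<bar>K * (\<Lambda> 1 - ((1 - p) + (p - q) * K + q * n))\<bar> \<le> K * \<delta>"
    by (simp add: abs_mult mult_left_mono)
  have "\<Lambda> 2 \<le> (1 - p) + (p - q) * K + \<delta>" "\<Lambda> 2 \<ge> (1 - p) + (p - q) * K - \<delta>"
    using r_ge_2 r_less_n by (auto intro!: upper_middle lower_middle)
  hence "\<bar>\<Lambda> 2 - ((1 - p) + (p - q) * K)\<bar> \<le> \<delta>" by linarith
  moreover have nK: "real n - real K \<ge> 0"
    using n_eq r_ge_2 mult_right_mono[of 1 "real r" "real K"] by simp
  ultimately have 2: "\<bar>(real n - K) * (\<Lambda> 2 - ((1 - p) + (p - q) * K))\<bar> \<le> (real n - K) * \<delta>"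
    by (simp add: abs_mult mult_left_mono)
  let ?num = "K * \<Lambda> 1 + (real n - K) * \<Lambda> 2 - n - p * (n * (real K - 1))"
  have "?num = K * (\<Lambda> 1 - ((1 - p) + (p - q) * K + q * n)) + (real n - K) * (\<Lambda> 2 - ((1 - p) + (p - q) * K))"
    by (simp add: algebra_simps)
  hence "\<bar>?num\<bar> \<le> K * \<delta> + (real n - K) * \<delta>" using 1 2 by linarith
  hence num: "\<bar>?num\<bar> \<le> n * \<delta>" by (simp add: algebra_simps)
  have pos: "n * (real K - 1) > 0" using n_pos K_ge_2 by simp
  have "z / D - p = (z - p * D) / D" if "D > 0" for z D :: real
    using that by (simp add: field_simps)
  hence "p_hat n (real K) (adj_matrix n E) - p = ?num / (n * (real K - 1))"
    unfolding p_hat_def using pos by blast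
  hence "\<bar>p_hat n (real K) (adj_matrix n E) - p\<bar> = \<bar>?num\<bar> / (n * (real K - 1))"
    using pos by (simp add: abs_divide)
  also have "\<dots> \<le> n * \<delta> / (n * (real K - 1))" using num pos by (intro divide_right_mono) auto
  also have "\<dots> = \<delta> / (real K - 1)" using n_pos by simp
  finally show ?thesis .
qed

text \<open>Both errors are at most 2 \<delta> / K; for \<open>p_hat\<close> the factor 2 comes from
  K - 1 \<ge> K / 2. By the gap assumption this is at most (p - q) / 4, exactly the distance allowed
  between t and (p + q) / 2.\<close>

lemma good_event_of_small_noise:
  assumes gap: "8 * \<delta> \<le> (p - q) * K" and \<delta>: "0 < \<delta>" "2 * \<delta> = c * sqrt (p * (1 - q) * real n)"
  shows "good_event n K p q c E"
  unfolding good_event_def Let_def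
proof (intro ballI)
  fix rh assume "rh \<in> gap_argmax n (adj_matrix n E)"
  hence "rh = r" using gap \<delta> by (intro gap_argmax_eq) auto
  hence Kh: "real n / real rh = real K" using n_eq r_ge_2 by simp
  have K0: "real K > 0" using K_ge_2 by simp
  have "\<delta> / (real K - 1) \<le> 2 * \<delta> / K"
  proof -
    have "real K \<le> 2 * (real K - 1)" using K_ge_2 by simp
    thus ?thesis using K_ge_2 \<delta>(1) by (simp add: field_simps)
  qed
  hence ph: "\<bar>p_hat n (real K) (adj_matrix n E) - p\<bar> \<le> 2 * \<delta> / K" using p_hat_error by linarith
  have "2 * \<delta> / n \<le> 2 * \<delta> / K"
    using n_eq r_ge_2 K0 \<delta>(1) by (intro divide_left_mono) auto
  hence qh: "\<bar>q_hat n (adj_matrix n E) - q\<bar> \<le> 2 * \<delta> / K" using q_hat_error by linarith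
  have "2 * \<delta> / K \<le> (p - q) / 4" using gap K0 by (simp add: field_simps)
  hence t: "p_hat n (real K) (adj_matrix n E) + q_hat n (adj_matrix n E) \<le> (p + q) + (p - q) / 2"
    "(p + q) - (p - q) / 2 \<le> p_hat n (real K) (adj_matrix n E) + q_hat n (adj_matrix n E)"
    using ph qh by linarith+
  show "real n / real rh = real K \<and>
     max \<bar>p_hat n (real n / real rh) (adj_matrix n E) - p\<bar> \<bar>q_hat n (adj_matrix n E) - q\<bar>
       \<le> c * sqrt (p * (1 - q) * real n) / real K \<and>
     p / 4 + 3 * q / 4 \<le> (p_hat n (real n / real rh) (adj_matrix n E) + q_hat n (adj_matrix n E)) / 2 \<and>
     (p_hat n (real n / real rh) (adj_matrix n E) + q_hat n (adj_matrix n E)) / 2 \<le> 3 * p / 4 + q / 4"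
    unfolding Kh \<delta>(2)[symmetric]
  proof (intro conjI)
    show "max \<bar>p_hat n (real K) (adj_matrix n E) - p\<bar> \<bar>q_hat n (adj_matrix n E) - q\<bar> \<le> 2 * \<delta> / real K"
      using ph qh by simp
  qed (use t in \<open>simp_all add: field_simps\<close>)
qed

end

section \<open>Numerical consequences of the separation hypothesis\<close>

text \<open>The first term of the maximum compares the gap with the noise scale and, since (p - q)^2
  \<le> v, forces n and K to be large. The second bounds the noise scale from below, through p - q
  \<le> 2 v and K \<le> n.\<close>

lemma separation_consequences:
  fixes p q c1 :: real
  assumes n: "n = r * K" "n > 0" "r \<ge> 2" and pq: "0 \<le> q" "q < p" "p \<le> 1" and c1: "c1 > 0"
    and sep: "(p - q) / sqrt (p * (1 - q)) \<ge>
          c1 * max (sqrt (real n) / real K) ((ln (real n))\<^sup>2 / sqrt (real K))"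
  defines "v \<equiv> p * (1 - q)"
  shows "0 < v" "v \<le> 1" "c1 * sqrt (real n * v) \<le> (p - q) * K" "c1\<^sup>2 \<le> n" "c1 \<le> K"
    "c1 * (ln (real n))\<^sup>2 \<le> 2 * sqrt (real n * v)"
proof -
  have K: "real K > 0" and nK: "real K \<le> real n" using n by auto
  show v0: "0 < v" using pq by (simp add: v_def)
  have q1: "1 - q > 0" "p > 0" using pq by auto
  show v1: "v \<le> 1" unfolding v_def using pq mult_mono[of p 1 "1 - q" 1] by auto
  have sv: "sqrt v > 0" using v0 by simp
  have A: "c1 * (sqrt (real n) / real K) \<le> (p - q) / sqrt v"
    and B: "c1 * ((ln (real n))\<^sup>2 / sqrt (real K)) \<le> (p - q) / sqrt v"
    using sep c1 mult_left_mono[OF max.cobounded1, of c1] mult_left_mono[OF max.cobounded2, of c1]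
    unfolding v_def by (meson less_imp_le order_trans)+
  show "c1 * sqrt (real n * v) \<le> (p - q) * K"
    using A K sv by (simp add: real_sqrt_mult field_simps)
  \<comment> \<open>Both p and 1 - q are at least p - q.\<close>
  have pq2: "(p - q)\<^sup>2 \<le> v"
  proof -
    have "(p - q) * (p - q) \<le> p * (1 - q)" using pq by (intro mult_mono) auto
    thus ?thesis by (simp add: v_def power2_eq_square)
  qed
  hence "p - q \<le> sqrt v" using pq by (simp add: real_le_rsqrt)
  hence le1: "(p - q) / sqrt v \<le> 1" using sv by simp
  hence "c1 * (sqrt (real n) / real K) \<le> 1" using A by linarith
  hence "c1 * sqrt (real n) \<le> real K" using K by (simp add: field_simps)
  hence cK: "c1 * sqrt (real n) \<le> real n" using nK by linarith
  have sn: "sqrt (real n) > 0" "sqrt (real n) * sqrt (real n) = real n" using n by auto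
  have "sqrt (real n) \<ge> 1" using n(2) by simp
  hence "c1 * 1 \<le> c1 * sqrt (real n)" using c1 by (intro mult_left_mono) auto
  with \<open>c1 * sqrt (real n) \<le> real K\<close> show "c1 \<le> K" by linarith
  have "c1 * sqrt (real n) \<le> sqrt (real n) * sqrt (real n)" using cK sn(2) by simp
  hence "c1 \<le> sqrt (real n)" using sn(1) by (rule mult_right_le_imp_le)
  hence "c1\<^sup>2 \<le> (sqrt (real n))\<^sup>2" using c1 by (intro power_mono) auto
  thus "c1\<^sup>2 \<le> n" by simp
  \<comment> \<open>The larger of p and 1 - q is at least 1/2, since they sum to more than 1.\<close>
  have "p - q \<le> 2 * v"
  proof (cases "p \<ge> 1/2")
    case True
    have "p - q \<le> 1 - q" using pq by simp
    also have "\<dots> \<le> (2 * p) * (1 - q)" using True q1 by simp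
    finally show ?thesis by (simp add: v_def)
  next
    case False
    have "p - q \<le> p" using pq by simp
    also have "\<dots> \<le> p * (2 * (1 - q))" using False q1 pq by simp
    finally show ?thesis by (simp only: v_def mult_ac)
  qed
  hence "(p - q) / sqrt v \<le> 2 * v / sqrt v" using sv by (intro divide_right_mono) auto
  also have "\<dots> = 2 * sqrt v" using real_div_sqrt[of v] v0 by simp
  finally have "c1 * ((ln (real n))\<^sup>2 / sqrt (real K)) \<le> 2 * sqrt v" using B by linarith
  hence "c1 * (ln (real n))\<^sup>2 \<le> 2 * sqrt v * sqrt (real K)" using K by (simp add: field_simps)
  also have "\<dots> \<le> 2 * sqrt v * sqrt (real n)" using sv nK by (intro mult_left_mono) auto
  finally show "c1 * (ln (real n))\<^sup>2 \<le> 2 * sqrt (real n * v)" by (simp add: real_sqrt_mult mult_ac)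
qed

text \<open>The hypotheses admit n = K = 0. The claimed bound is then 1, because
  \<open>0 powr (-8)\<close> is 0, but with no candidate position the event holds vacuously.\<close>

lemma good_event_empty: "good_event 0 K p q c E"
  by (simp add: good_event_def gap_argmax_def Let_def)

theorem theorem3:
  "\<exists>c1>0. \<exists>c0>0. \<exists>c4>0.
     \<forall>n r K (cl :: nat \<Rightarrow> nat) (p :: real) (q :: real).
       n = r * K \<longrightarrow> r \<ge> 2 \<longrightarrow> balanced_clusters n r K cl \<longrightarrow>
       0 \<le> q \<longrightarrow> q < p \<longrightarrow> p \<le> 1 \<longrightarrow>
       (p - q) / sqrt (p * (1 - q)) \<ge>
          c1 * max (sqrt (real n) / real K) ((ln (real n))\<^sup>2 / sqrt (real K)) \<longrightarrow>
       measure_pmf.prob (sbm n cl p q) {E. good_event n K p q c4 E}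
          \<ge> 1 - c0 * real n powr (-8)"
\<comment> \<open>The errors are 2 \<delta> / K with \<delta> = 12 s, hence 24. The value 300 is set
  by the walk length: 2 k + 1 \<le> 12 ln n calls for 144 (ln n)^2 \<le> s, and the hypothesis
  supplies 150 (ln n)^2 \<le> s. The gap condition would be content with 96.\<close>
proof (rule exI[of _ "300::real"], rule conjI, simp, rule exI[of _ "1::real"], rule conjI, simp,
    rule exI[of _ "24::real"], rule conjI, simp, intro allI impI)
  fix n r K :: nat and cl :: "nat \<Rightarrow> nat" and p q :: real
  assume n: "n = r * K" and r: "r \<ge> 2" and bal: "balanced_clusters n r K cl"
    and pq: "0 \<le> q" "q < p" "p \<le> 1"
    and sep: "(p - q) / sqrt (p * (1 - q)) \<ge>
          300 * max (sqrt (real n) / real K) ((ln (real n))\<^sup>2 / sqrt (real K))"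
  show "measure_pmf.prob (sbm n cl p q) {E. good_event n K p q 24 E} \<ge> 1 - 1 * real n powr (-8)"
  proof (cases "n = 0")
    case True
    thus ?thesis by (simp add: good_event_empty)
  next
    case False
    define v where "v = p * (1 - q)"
    define s where "s = sqrt (real n * v)"
    note cons = separation_consequences[OF n _ r pq _ sep, folded v_def, folded s_def]
    have v: "0 < v" "v \<le> 1" and gap: "300 * s \<le> (p - q) * K" and n_large: "90000 \<le> real n"
      and K: "K \<ge> 300" and log: "300 * (ln (real n))\<^sup>2 \<le> 2 * s"
      using cons False by auto
    have s: "0 < s" "s\<^sup>2 = real n * v" using v False by (auto simp: s_def)
    \<comment> \<open>2 k \<ge> 9 ln n gives 3^(2 k) \<ge> n^9. Rounding up and adding 1 cost at
      most 3 \<le> 3 ln n, whence 2 k + 1 \<le> 12 ln n.\<close>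
    define k where "k = nat \<lceil>9 / 2 * ln (real n)\<rceil>"
    have ln1: "ln (real n) \<ge> 1"
    proof -
      have "exp 1 \<le> real n" using exp_le n_large by linarith
      thus ?thesis using False by (simp add: ln_ge_iff)
    qed
    have k: "9 * ln (real n) \<le> real (2 * k)" "real (2 * k + 1) \<le> 12 * ln (real n)" "k > 0"
      using ln1 by (auto simp: k_def) linarith+
    have "(real (2 * k + 1))\<^sup>2 \<le> (12 * ln (real n))\<^sup>2" using k(2) by (intro power_mono) auto
    also have "\<dots> = 144 * (ln (real n))\<^sup>2" by (simp add: power_mult_distrib)
    finally have L: "(real (2 * k + 1))\<^sup>2 \<le> s" using log zero_le_power2[of "ln (real n)"] by linarith
    let ?pr = "edge_prob cl p q"
    have pr: "0 \<le> ?pr e \<and> ?pr e \<le> 1 \<and> ?pr e * (1 - ?pr e) \<le> v" for e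
    proof -
      have "p * (1 - p) \<le> v" "q * (1 - q) \<le> v"
        unfolding v_def using pq by (auto intro!: mult_left_mono mult_right_mono)
      thus ?thesis using pq by (auto simp: edge_prob_def split: prod.split)
    qed
    have tail: "real n / 3 ^ (2 * k) \<le> real n powr (-8)"
    proof -
      have "real n powr 9 = exp (9 * ln (real n))" using False by (simp add: powr_def)
      also have "\<dots> \<le> exp (real (2 * k))" using k(1) by simp
      also have "\<dots> = exp 1 ^ (2 * k)" by (subst exp_of_nat_mult[symmetric]) simp
      also have "\<dots> \<le> 3 ^ (2 * k)" using exp_le by (intro power_mono) auto
      finally have "real n / 3 ^ (2 * k) \<le> real n / real n powr 9"
        using False by (intro divide_left_mono) auto
      also have "\<dots> = real n powr (1 - 9)" using False by (subst powr_diff) auto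
      finally show ?thesis by simp
    qed
    have "1 - real n powr (-8) \<le> measure_pmf.prob (random_graph n ?pr)
      {E. \<forall>x. \<bar>dotp n x (mvec n (noise ?pr E) x)\<bar> \<le> 12 * s * dotp n x x}"
      using noise_quadratic_form_whp[of ?pr, OF pr v(2) s L k(3)] tail by linarith
    also have "\<dots> \<le> measure_pmf.prob (random_graph n ?pr) {E. good_event n K p q 24 E}"
    proof (rule measure_pmf.finite_measure_mono)
      show "{E. \<forall>x. \<bar>dotp n x (mvec n (noise ?pr E) x)\<bar> \<le> 12 * s * dotp n x x} \<subseteq> {E. good_event n K p q 24 E}"
      proof (intro subsetI CollectI)
        fix E assume "E \<in> {E. \<forall>x. \<bar>dotp n x (mvec n (noise ?pr E) x)\<bar> \<le> 12 * s * dotp n x x}"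
        hence E: "\<forall>x. \<bar>dotp n x (mvec n (noise ?pr E) x)\<bar> \<le> 12 * s * dotp n x x" by simp
        interpret balanced_sbm n r K cl p q "12 * s" E
          using n bal K r pq E by unfold_locales auto
        show "good_event n K p q 24 E"
        proof (rule good_event_of_small_noise)
          show "8 * (12 * s) \<le> (p - q) * K" using gap s(1) by linarith
          show "2 * (12 * s) = 24 * sqrt (p * (1 - q) * real n)" by (simp add: s_def v_def mult.commute)
        qed (use s in simp)
      qed
    qed simp
    finally show ?thesis by (simp add: sbm_eq_random_graph)
  qed
qed

end
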